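(* Let $n\geq 5$, let $K\leq\mathrm{Aut}(Q_n)$ be even with $d_K\geq 7$, and let $\Gamma$ be a halved graph of $(Q_n)_K$. Then $\mathrm{Aut}(\Gamma)=N_{E_n: S_n}(K)/K$, where $N_{E_n:S_n}(K)$ acts on vertices by $(x^K)^g:=(x^g)^K$.
   Context: The $n$-cube $Q_n$ has vertex set $\mathbb{F}_2^n$, two vectors adjacent iff their Hamming distance is $1$; $\mathrm{Aut}(Q_n)=\mathbb{F}_2^n: S_n$, where $\mathbb{F}_2^n$ acts by translation and $S_n$ by permuting coordinates; elements are written $(x,\sigma)$. $E_n$ is the subspace of even-weight vectors, so $E_n: S_n$ is an index-$2$ subgroup of $\mathrm{Aut}(Q_n)$; $K\leq\mathrm{Aut}(Q_n)$ is even if $K\leq E_n: S_n$. For $K\leq\mathrm{Aut}(Q_n)$, $d_K:=\min\{d_{Q_n}(x,x^k): x\in\mathbb{F}_2^n,\ 1\neq k\in K\}$ if $K\neq 1$ and $d_K:=\infty$ if $K=1$. The normal quotient $(Q_n)_K$ is the simple graph whose vertices are the $K$-orbits $x^K$, distinct orbits adjacent iff some vertex of one is adjacent in $Q_n$ to some vertex of the other. For a connected bipartite graph $\Pi$, the halved graphs are the two connected components of the distance $2$ graph of $\Pi$ (same vertex set, adjacency = distance exactly $2$ in $\Pi$). *)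

theory Defs
  imports
    "HOL-Analysis.Finite_Cartesian_Product"
    "HOL-Library.Z2"
    "HOL-Combinatorics.Permutations"
    "HOL-Algebra.Algebra"
    "Graph_Theory.Graph_Theory"
begin

text \<open>Simple graphs are symmetric loop-free digraphs without parallel arcs, i.e. records of type
  \<^typ>\<open>'a pair_pre_digraph\<close>; \<^const>\<open>with_proj\<close> embeds them into \<^typ>\<open>('a, 'a \<times> 'a) pre_digraph\<close>.
  The graph distance is the library's shortest-path length with all arc weights equal to 1.\<close>

definition gdist :: "'a pair_pre_digraph \<Rightarrow> 'a \<Rightarrow> 'a \<Rightarrow> ereal" where
  "gdist G u v = wf_digraph.\<mu> (with_proj G) (\<lambda>_. 1) u v"

text \<open>Automorphisms are permutations of the vertices (extensional functions, as in
  \<^const>\<open>BijGroup\<close>); multiplication is composition of functions.\<close>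

definition aut_group :: "('a, 'a \<times> 'a) pre_digraph \<Rightarrow> ('a \<Rightarrow> 'a) monoid" where
  "aut_group G = (BijGroup (verts G))
     \<lparr>carrier := {f \<in> Bij (verts G).
        \<forall>u \<in> verts G. \<forall>v \<in> verts G. (f u \<rightarrow>\<^bsub>G\<^esub> f v) \<longleftrightarrow> (u \<rightarrow>\<^bsub>G\<^esub> v)}\<rparr>"

definition distance2_graph :: "'a pair_pre_digraph \<Rightarrow> 'a pair_pre_digraph" where
  "distance2_graph G = \<lparr>pverts = pverts G,
     parcs = {(u, v). u \<in> pverts G \<and> v \<in> pverts G \<and> gdist G u v = 2}\<rparr>"

text \<open>Strongly connected components of a symmetric digraph are its connected components. For a
  connected bipartite graph with at least two vertices there are exactly two halved graphs.\<close>

definition halved_graphs :: "'a pair_pre_digraph \<Rightarrow> ('a, 'a \<times> 'a) pre_digraph set" where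
  "halved_graphs G = pre_digraph.sccs (with_proj (distance2_graph G))"

definition orb :: "('a \<Rightarrow> 'a) set \<Rightarrow> 'a \<Rightarrow> 'a set" where
  "orb K x = Group_Action.orbit ((BijGroup UNIV)\<lparr>carrier := K\<rparr>) (\<lambda>k. k) x"

definition normal_quotient :: "'a pair_pre_digraph \<Rightarrow> ('a \<Rightarrow> 'a) set \<Rightarrow> 'a set pair_pre_digraph" where
  "normal_quotient G K = \<lparr>pverts = orb K ` pverts G,
     parcs = {(A, B). A \<in> orb K ` pverts G \<and> B \<in> orb K ` pverts G \<and> A \<noteq> B \<and>
                      (\<exists>a \<in> A. \<exists>b \<in> B. (a, b) \<in> parcs G)}\<rparr>"

text \<open>The infimum of the empty set is \<^term>\<open>\<infinity> :: ereal\<close>, which covers the trivial group.\<close>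

definition min_displacement :: "'a pair_pre_digraph \<Rightarrow> ('a \<Rightarrow> 'a) set \<Rightarrow> ereal" where
  "min_displacement G K =
     (INF (x, k) \<in> pverts G \<times> (K - {\<one>\<^bsub>aut_group (with_proj G)\<^esub>}). gdist G x (k x))"

definition hamming_weight :: "bit ^ 'n \<Rightarrow> nat" where
  "hamming_weight x = card {i. x $ i \<noteq> 0}"

definition hamming_dist :: "bit ^ 'n \<Rightarrow> bit ^ 'n \<Rightarrow> nat" where
  "hamming_dist x y = card {i. x $ i \<noteq> y $ i}"

definition cube :: "(bit ^ 'n) pair_pre_digraph" where
  "cube = \<lparr>pverts = UNIV, parcs = {(x, y). hamming_dist x y = 1}\<rparr>"

text \<open>The element \<open>(x, \<sigma>)\<close>: translate by \<open>x\<close>, then move the entry in position \<open>i\<close> to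
  position \<open>\<sigma> i\<close>.\<close>

definition cube_map :: "bit ^ 'n \<Rightarrow> ('n \<Rightarrow> 'n) \<Rightarrow> bit ^ 'n \<Rightarrow> bit ^ 'n" where
  "cube_map x \<sigma> v = (\<chi> i. (v + x) $ (inv_into UNIV \<sigma> i))"

definition even_vectors :: "(bit ^ 'n) set" where
  "even_vectors = {x. even (hamming_weight x)}"

text \<open>The subgroup \<open>E\<^sub>n : S\<^sub>n\<close> of the automorphism group of the cube.\<close>

definition even_cube_maps :: "(bit ^ 'n \<Rightarrow> bit ^ 'n) set" where
  "even_cube_maps = {cube_map x \<sigma> | x \<sigma>. x \<in> even_vectors \<and> \<sigma> permutes UNIV}"

definition even_cube_group :: "(bit ^ 'n \<Rightarrow> bit ^ 'n) monoid" where
  "even_cube_group = (aut_group (with_proj cube))\<lparr>carrier := even_cube_maps\<rparr>"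

end

theory Submission
  imports Defs
begin

text \<open>
  Since \<open>K\<close> is even and \<open>d\<^sub>K \<ge> 7\<close>, the halved graphs of the quotient consist of the \<open>K\<close>-orbits on
  the vectors of one parity, two orbits being adjacent iff they contain vectors at distance 2.
  Distinct vectors at distance at most 6 lie in different orbits, so the orbit map is injective on
  balls of radius 2 and preserves and reflects adjacency there. The neighbourhood of an orbit is
  therefore the triangular graph \<open>T(n)\<close>, whose automorphisms come from \<open>S\<^sub>n\<close> for \<open>n \<ge> 5\<close>.

  Hence an automorphism \<open>f\<close> of a halved graph lifts, on the ball of radius 2 around each vector, to
  an element of \<open>E\<^sub>n : S\<^sub>n\<close>. Lifts at adjacent vectors agree because they agree on common neighbours,
  so \<open>f\<close> lifts globally to some \<open>g\<close>. An element of \<open>E\<^sub>n : S\<^sub>n\<close> that fixes all orbits of one parity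
  acts on each vector as some element of \<open>K\<close>, which is locally constant, so it belongs to \<open>K\<close>. This
  shows both that \<open>g\<close> normalizes \<open>K\<close> and that the action of the normalizer has kernel \<open>K\<close>.
\<close>

section \<open>Vectors as sets of coordinates\<close>

text \<open>A vector over F_2 is identified with the set of its ones, which turns addition into
  symmetric difference and Hamming distance into a cardinality.\<close>

definition supp :: "bit ^ 'n \<Rightarrow> 'n set" where
  "supp v = {i. v $ i = 1}"

text \<open>Translation by the indicator vector of \<open>S\<close>. Every vector is
  \<open>flip S v\<close> for exactly one \<open>S\<close>, so each \<open>v\<close> can serve as
  the origin.\<close>

definition flip :: "'n set \<Rightarrow> bit ^ 'n \<Rightarrow> bit ^ 'n" where
  "flip S v = (\<chi> i. of_bool (i \<in> sym_diff S (supp v)))"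

lemma supp_eq_iff: "supp v = supp w \<longleftrightarrow> v = w"
proof
  assume *: "supp v = supp w"
  have "v $ i = w $ i" for i
  proof -
    have "v $ i = 1 \<longleftrightarrow> w $ i = 1" using * by (auto simp: supp_def set_eq_iff)
    then show ?thesis by (cases "v $ i"; cases "w $ i"; simp)
  qed
  then show "v = w" by (simp add: vec_eq_iff)
qed simp

lemma supp_flip [simp]: "supp (flip S v) = sym_diff S (supp v)"
  by (auto simp: flip_def supp_def)

lemma supp_add: "supp (v + w) = sym_diff (supp v) (supp w)"
proof -
  have "(v + w) $ i = 1 \<longleftrightarrow> (v $ i = 1) \<noteq> (w $ i = 1)" for i
    by (cases "v $ i"; cases "w $ i"; simp)
  then show ?thesis unfolding supp_def by blast
qed

lemma hamming_dist_supp: "hamming_dist v w = card (sym_diff (supp v) (supp w))"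
proof -
  have "v $ i \<noteq> w $ i \<longleftrightarrow> (v $ i = 1) \<noteq> (w $ i = 1)" for i
    by (cases "v $ i"; cases "w $ i"; simp)
  then have "{i. v $ i \<noteq> w $ i} = sym_diff (supp v) (supp w)"
    unfolding supp_def by blast
  then show ?thesis by (simp add: hamming_dist_def)
qed

lemma hamming_weight_supp: "hamming_weight v = card (supp v)"
  by (simp add: hamming_weight_def supp_def)

lemma flip_empty [simp]: "flip {} v = v"
  by (simp add: supp_eq_iff[symmetric])

lemma flip_flip: "flip S (flip T v) = flip (sym_diff S T) v"
  by (simp only: supp_eq_iff[symmetric] supp_flip) blast

lemma flip_flip_cancel [simp]: "flip S (flip S v) = v"
  by (simp add: flip_flip)

lemma flip_eq_iff [simp]: "flip S v = flip T v \<longleftrightarrow> S = T"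
  by (simp only: supp_eq_iff[symmetric] supp_flip) blast

lemma flip_eq_self_iff [simp]: "flip S v = v \<longleftrightarrow> S = {}"
  using flip_eq_iff[of S v "{}"] by simp

lemma flipE:
  obtains S where "w = flip S v"
proof
  show "w = flip (sym_diff (supp v) (supp w)) v"
    by (simp only: supp_eq_iff[symmetric] supp_flip) blast
qed

lemma hamming_dist_flip_flip: "hamming_dist (flip S v) (flip T v) = card (sym_diff S T)"
  unfolding hamming_dist_supp supp_flip by (rule arg_cong[where f = card]) blast

lemma hamming_dist_flip [simp]: "hamming_dist v (flip S v) = card S"
  using hamming_dist_flip_flip[of "{}" v S] by simp

lemma hamming_distE:
  assumes "hamming_dist v w = d"
  obtains S where "card S = d" "w = flip S v"
  by (metis assms flipE hamming_dist_flip)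

lemma hamming_dist_commute: "hamming_dist v w = hamming_dist w v"
  unfolding hamming_dist_supp by (rule arg_cong[where f = card]) blast

lemma hamming_dist_eq_0_iff [simp]: "hamming_dist v w = 0 \<longleftrightarrow> v = w"
  unfolding hamming_dist_supp supp_eq_iff[symmetric] card_eq_0_iff by auto

lemma hamming_dist_self [simp]: "hamming_dist v v = 0"
  by simp

lemma hamming_dist_triangle: "hamming_dist u w \<le> hamming_dist u v + hamming_dist v w"
proof -
  have "hamming_dist u w \<le> card (sym_diff (supp u) (supp v) \<union> sym_diff (supp v) (supp w))"
    unfolding hamming_dist_supp by (rule card_mono) auto
  also have "\<dots> \<le> hamming_dist u v + hamming_dist v w"
    unfolding hamming_dist_supp by (rule card_Un_le)
  finally show ?thesis .
qed

text \<open>True on the even half, False on the odd half of the bipartition of the cube; one boolean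
  then names a halved graph.\<close>

definition parity :: "bit ^ 'n \<Rightarrow> bool" where
  "parity v = even (hamming_weight v)"

text \<open>Common elements count twice on the right and not at all in the symmetric difference.
  Besides parity, this gives that two 2-sets meet in one point iff their symmetric difference has
  two elements.\<close>

lemma card_sym_diff_Int:
  fixes A B :: "'a::finite set"
  shows "card (sym_diff A B) + 2 * card (A \<inter> B) = card A + card B"
proof -
  have "card (sym_diff A B) = card (A - B) + card (B - A)"
    by (rule card_Un_disjoint) auto
  moreover have "card A = card (A - B) + card (A \<inter> B)" "card B = card (B - A) + card (A \<inter> B)"
    by (subst card_Un_disjoint[symmetric]; auto intro!: arg_cong[where f = card])+
  ultimately show ?thesis by simp
qed

lemma even_card_sym_diff_iff:
  fixes A B :: "'a::finite set"
  shows "even (card (sym_diff A B)) \<longleftrightarrow> (even (card A) \<longleftrightarrow> even (card B))"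
  using card_sym_diff_Int[of A B] by presburger

lemma even_hamming_dist_iff: "even (hamming_dist v w) \<longleftrightarrow> parity v = parity w"
  by (simp add: parity_def hamming_weight_supp hamming_dist_supp even_card_sym_diff_iff)

lemma parity_flip: "parity (flip S v) \<longleftrightarrow> (even (card S) \<longleftrightarrow> parity v)"
  by (simp add: parity_def hamming_weight_supp even_card_sym_diff_iff)

section \<open>The group of even cube maps\<close>

lemma supp_cube_map:
  assumes "bij \<sigma>"
  shows "supp (cube_map x \<sigma> v) = \<sigma> ` sym_diff (supp v) (supp x)"
proof -
  have "i \<in> supp (cube_map x \<sigma> v) \<longleftrightarrow> inv_into UNIV \<sigma> i \<in> supp (v + x)" for i
    by (simp add: cube_map_def supp_def)
  moreover have "inv_into UNIV \<sigma> i \<in> T \<longleftrightarrow> i \<in> \<sigma> ` T" for i T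
    using assms by (metis bij_inv_eq_iff image_iff)
  ultimately show ?thesis unfolding supp_add by blast
qed

text \<open>The translation part cancels in differences, and the image under an injective map
  commutes with symmetric difference.\<close>

lemma cube_map_flip:
  assumes "bij \<sigma>"
  shows "cube_map x \<sigma> (flip S v) = flip (\<sigma> ` S) (cube_map x \<sigma> v)"
  using bij_is_inj[OF assms]
  by (simp add: supp_eq_iff[symmetric] supp_cube_map[OF assms] image_Un image_set_diff) blast

lemma card_bij_image:
  assumes "bij \<sigma>"
  shows "card (\<sigma> ` S) = card S"
  using assms by (meson bij_is_inj card_image inj_on_subset subset_UNIV)

lemma parity_cube_map:
  assumes "bij \<sigma>"
  shows "parity (cube_map x \<sigma> v) = (parity v = parity x)"
  by (simp add: parity_def hamming_weight_supp supp_cube_map[OF assms] card_bij_image[OF assms]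
      even_card_sym_diff_iff)

lemma even_vectors_parity: "x \<in> even_vectors \<longleftrightarrow> parity x"
  by (simp add: even_vectors_def parity_def)

lemma even_cube_mapE:
  assumes "g \<in> even_cube_maps"
  obtains \<sigma> where "bij \<sigma>" "\<And>S v. g (flip S v) = flip (\<sigma> ` S) (g v)"
proof -
  obtain x \<sigma> where g: "g = cube_map x \<sigma>" "\<sigma> permutes UNIV"
    using assms by (auto simp: even_cube_maps_def)
  then have b: "bij \<sigma>" by (simp add: permutes_bij)
  show ?thesis by (rule that[OF b]) (simp add: g(1) cube_map_flip[OF b])
qed

lemma parity_even_cube_map:
  assumes "g \<in> even_cube_maps"
  shows "parity (g v) = parity v"
  using assms by (auto simp: even_cube_maps_def even_vectors_parity parity_cube_map permutes_bij)

text \<open>Once \<open>\<sigma>\<close> is chosen, the translation part is forced by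
  \<open>x\<close> going to \<open>y\<close>; it is even because \<open>\<sigma>\<close> preserves
  weights and \<open>x\<close>, \<open>y\<close> have equal parity.\<close>

lemma ex_even_cube_map:
  assumes "parity x = parity y" "bij \<sigma>"
  shows "\<exists>g \<in> even_cube_maps. \<forall>S. g (flip S x) = flip (\<sigma> ` S) y"
proof -
  \<comment> \<open>The solution \<open>t\<close> of sigma(x + t) = y.\<close>
  define t where "t = flip (inv_into UNIV \<sigma> ` supp y) x"
  let ?g = "cube_map t \<sigma>"
  have "card (inv_into UNIV \<sigma> ` supp y) = card (supp y)"
    using bij_imp_bij_inv[OF assms(2)] by (rule card_bij_image)
  then have "parity t"
    using assms(1) by (simp add: t_def parity_flip) (simp add: parity_def hamming_weight_supp)
  moreover have "?g x = y"
  proof -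
    have "supp (?g x) = \<sigma> ` inv_into UNIV \<sigma> ` supp y"
      unfolding supp_cube_map[OF assms(2)] t_def supp_flip by (rule arg_cong[where f = "image \<sigma>"]) blast
    also have "\<dots> = supp y"
      using assms(2) by (simp add: bij_is_surj image_f_inv_f)
    finally show ?thesis by (simp add: supp_eq_iff)
  qed
  moreover have "\<sigma> permutes UNIV" using assms(2) by (simp add: permutes_univ bij_iff)
  ultimately show ?thesis
    unfolding even_cube_maps_def by (intro bexI[of _ ?g])
      (auto simp: cube_map_flip[OF assms(2)] even_vectors_parity)
qed

text \<open>A description free of the translation vector: such a map is determined by
  \<open>\<sigma>\<close> and its value at 0, and \<open>ex_even_cube_map\<close> supplies an even
  cube map with the same data. Closure under composition and inverse is checked in this
  form.\<close>

lemma even_cube_maps_iff: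
  fixes g :: "bit ^ 'n \<Rightarrow> bit ^ 'n"
  shows "g \<in> even_cube_maps \<longleftrightarrow>
     (\<exists>\<sigma>. bij \<sigma> \<and> (\<forall>S v. g (flip S v) = flip (\<sigma> ` S) (g v))) \<and> (\<forall>v. parity (g v) = parity v)"
  (is "?L \<longleftrightarrow> ?R")
proof
  assume ?L then show ?R using even_cube_mapE parity_even_cube_map by metis
next
  assume ?R
  then obtain \<sigma> where "bij \<sigma> \<and> (\<forall>S v. g (flip S v) = flip (\<sigma> ` S) (g v))" "parity (g 0) = parity (0 :: bit ^ 'n)"
    by blast
  then have s: "bij \<sigma>" "\<And>S v. g (flip S v) = flip (\<sigma> ` S) (g v)" "parity (0 :: bit ^ 'n) = parity (g 0)"
    by auto
  then obtain h where h: "h \<in> even_cube_maps" "\<And>S. h (flip S 0) = flip (\<sigma> ` S) (g 0)"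
    using ex_even_cube_map[OF s(3,1)] by blast
  have "g v = h v" for v using h(2) s(2) by (metis flipE)
  with h show ?L by (metis ext)
qed

lemma hamming_dist_even_cube_map [simp]:
  assumes "g \<in> even_cube_maps"
  shows "hamming_dist (g v) (g w) = hamming_dist v w"
proof -
  obtain \<sigma> where s: "bij \<sigma>" "\<And>S v. g (flip S v) = flip (\<sigma> ` S) (g v)"
    using assms even_cube_mapE by blast
  obtain S where "w = flip S v" by (rule flipE)
  then show ?thesis using s by (simp add: card_bij_image)
qed

lemma bij_even_cube_map:
  fixes g :: "bit ^ 'n \<Rightarrow> bit ^ 'n"
  assumes "g \<in> even_cube_maps"
  shows "bij g"
proof -
  have "inj g" using hamming_dist_even_cube_map[OF assms] by (metis hamming_dist_eq_0_iff injI)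
  moreover have "w \<in> range g" for w
  proof -
    obtain \<sigma> where s: "bij \<sigma>" "\<And>S v. g (flip S v) = flip (\<sigma> ` S) (g v)"
      using assms even_cube_mapE by blast
    obtain S where "w = flip S (g 0)" by (rule flipE)
    then have "w = g (flip (inv_into UNIV \<sigma> ` S) 0)"
      using s by (simp add: bij_is_surj image_f_inv_f)
    then show ?thesis by blast
  qed
  ultimately show ?thesis by (auto simp: bij_def)
qed

lemma even_cube_maps_comp:
  assumes "g \<in> even_cube_maps" "h \<in> even_cube_maps"
  shows "g \<circ> h \<in> even_cube_maps"
proof -
  obtain \<sigma> \<tau> where s: "bij \<sigma>" "\<And>S v. g (flip S v) = flip (\<sigma> ` S) (g v)"
    and t: "bij \<tau>" "\<And>S v. h (flip S v) = flip (\<tau> ` S) (h v)"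
    using assms by (metis even_cube_mapE)
  have "bij (\<sigma> \<circ> \<tau>)" using s t by (simp add: bij_comp)
  moreover have "(g \<circ> h) (flip S v) = flip ((\<sigma> \<circ> \<tau>) ` S) ((g \<circ> h) v)" for S v
    by (simp add: s t image_comp)
  ultimately show ?thesis unfolding even_cube_maps_iff
    using parity_even_cube_map assms by (metis comp_apply)
qed

lemma even_cube_maps_id: "id \<in> even_cube_maps"
  unfolding even_cube_maps_iff by (auto intro!: exI[of _ id])

lemma even_cube_maps_inv:
  assumes "g \<in> even_cube_maps"
  shows "inv_into UNIV g \<in> even_cube_maps"
proof -
  note b = bij_even_cube_map[OF assms]
  obtain \<sigma> where s: "bij \<sigma>" "\<And>S v. g (flip S v) = flip (\<sigma> ` S) (g v)"
    using assms by (metis even_cube_mapE)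
  have "inv_into UNIV g (flip S v) = flip (inv_into UNIV \<sigma> ` S) (inv_into UNIV g v)" for S v
  proof -
    have "g (flip (inv_into UNIV \<sigma> ` S) (inv_into UNIV g v)) = flip S v"
      by (simp add: s(2) bij_is_surj[OF s(1)] bij_is_surj[OF b] image_f_inv_f surj_f_inv_f)
    then show ?thesis using b by (metis bij_inv_eq_iff)
  qed
  moreover have "parity (inv_into UNIV g v) = parity v" for v
    using parity_even_cube_map[OF assms, of "inv_into UNIV g v"] b by (simp add: bij_is_surj surj_f_inv_f)
  ultimately show ?thesis unfolding even_cube_maps_iff using bij_imp_bij_inv[OF s(1)] by blast
qed

section \<open>Pairs of coordinates and the triangular graph\<close>

text \<open>Pairwise meeting 2-sets without a common point are the sides of a triangle, and a
  triangle has only three sides.\<close>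

lemma pairwise_meeting_pairs_common_point:
  assumes "finite C" "card C \<ge> 4" "inj_on P C"
    and "\<And>c. c \<in> C \<Longrightarrow> card (P c) = 2"
    and "\<And>c d. c \<in> C \<Longrightarrow> d \<in> C \<Longrightarrow> c \<noteq> d \<Longrightarrow> P c \<inter> P d \<noteq> {}"
  shows "\<exists>b. \<forall>c \<in> C. b \<in> P c"
proof -
  \<comment> \<open>The case \<open>A = B\<close> is covered because 2-sets are nonempty.\<close>
  have meet: "A \<inter> B \<noteq> {}" if "A \<in> P ` C" "B \<in> P ` C" for A B
    using that assms(4,5) by (metis (no_types, lifting) Int_absorb card.empty image_iff zero_neq_numeral)
  have two: "card A = 2" if "A \<in> P ` C" for A using that assms by auto
  have card_ge: "card (P ` C) \<ge> 4" using assms by (simp add: card_image)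
  then obtain A where A: "A \<in> P ` C" by fastforce
  then obtain p q where pq: "A = {p, q}" "p \<noteq> q" using two by (meson card_2_iff)
  have "\<exists>b. \<forall>B \<in> P ` C. b \<in> B"
  proof (rule ccontr)
    assume contr: "\<not> (\<exists>b. \<forall>B \<in> P ` C. b \<in> B)"
    \<comment> \<open>Some member avoids \<open>p\<close> and some member avoids \<open>q\<close>;
      with \<open>A\<close> they form the triangle on \<open>p\<close>, \<open>q\<close>,
      \<open>r\<close>, and a pair meeting all three sides is itself a side.\<close>
    obtain B where B: "B \<in> P ` C" "p \<notin> B" using contr by blast
    then have "q \<in> B" using meet[OF A B(1)] pq by auto
    then obtain r where r: "B = {q, r}" "q \<noteq> r" using two[OF B(1)]
      by (metis card_2_iff insertE insert_commute singletonD)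
    obtain D where D: "D \<in> P ` C" "q \<notin> D" using contr by blast
    have "p \<in> D" "r \<in> D" using meet[OF A D(1)] meet[OF B(1) D(1)] D(2) pq r by auto
    moreover have "p \<noteq> r" using B r by auto
    ultimately have Deq: "D = {p, r}" using two[OF D(1)] by (auto simp: card_2_iff)
    have "P ` C \<subseteq> {{p, q}, {q, r}, {p, r}}"
    proof
      fix Z assume Z: "Z \<in> P ` C"
      obtain a b where ab: "Z = {a, b}" "a \<noteq> b" using two[OF Z] by (meson card_2_iff)
      show "Z \<in> {{p, q}, {q, r}, {p, r}}"
        using meet[OF Z A] meet[OF Z B(1)] meet[OF Z D(1)] pq r Deq ab \<open>p \<noteq> r\<close> by auto
    qed
    then have "card (P ` C) \<le> card {{p, q}, {q, r}, {p, r}}" by (intro card_mono) auto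
    also have "\<dots> \<le> 3" by (simp add: card_insert_if)
    finally show False using card_ge by simp
  qed
  then show ?thesis by blast
qed

text \<open>A special case of Whitney's theorem on line graphs. For \<open>n = 4\<close> it fails: exchanging one
  pair with its complement preserves the triangular graph \<open>T(4)\<close>.\<close>

lemma triangular_graph_automorphism:
  fixes \<phi> :: "'n::finite set \<Rightarrow> 'n set"
  assumes n: "CARD('n) \<ge> 5"
    and two: "\<And>A. card A = 2 \<Longrightarrow> card (\<phi> A) = 2"
    and inj: "inj_on \<phi> {A. card A = 2}"
    and meet: "\<And>A B. card A = 2 \<Longrightarrow> card B = 2 \<Longrightarrow> card (A \<inter> B) = 1 \<Longrightarrow> card (\<phi> A \<inter> \<phi> B) = 1"
  shows "\<exists>\<sigma>. bij \<sigma> \<and> (\<forall>A. card A = 2 \<longrightarrow> \<phi> A = \<sigma> ` A)"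
proof -
  \<comment> \<open>The at least four pairs through \<open>a\<close> go to pairwise meeting pairs;
    their common point becomes the image of \<open>a\<close>.\<close>
  have star: "\<exists>b. \<forall>c \<in> - {a}. b \<in> \<phi> {a, c}" for a
  proof (rule pairwise_meeting_pairs_common_point)
    show "card (- {a}) \<ge> 4" using n by (simp add: Compl_eq_Diff_UNIV card_Diff_singleton)
    show "inj_on (\<lambda>c. \<phi> {a, c}) (- {a})"
    proof (rule inj_onI)
      fix c d assume "c \<in> - {a}" "d \<in> - {a}" "\<phi> {a, c} = \<phi> {a, d}"
      then have "{a, c} = {a, d}" using inj_onD[OF inj, of "{a, c}" "{a, d}"] by auto
      then show "c = d" by (auto simp: doubleton_eq_iff)
    qed
    show "\<phi> {a, c} \<inter> \<phi> {a, d} \<noteq> {}" if "c \<in> - {a}" "d \<in> - {a}" "c \<noteq> d" for c d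
    proof -
      have "{a, c} \<inter> {a, d} = {a}" using that by auto
      then show ?thesis using that meet[of "{a, c}" "{a, d}"] by auto
    qed
  qed (use two in auto)
  then obtain \<sigma> where \<sigma>: "\<And>a c. a \<noteq> c \<Longrightarrow> \<sigma> a \<in> \<phi> {a, c}" by (metis ComplI singletonD)
  have "inj \<sigma>"
  proof (rule injI, rule ccontr)
    fix a b assume ab: "\<sigma> a = \<sigma> b" "a \<noteq> b"
    \<comment> \<open>The 2n - 3 pairs through \<open>a\<close> or \<open>b\<close>, with
      \<open>{a, b}\<close> counted in \<open>?A\<close> alone, would be injected into the n - 1
      pairs through \<open>\<sigma> a\<close>, forcing n \<le> 2.\<close>
    let ?A = "(\<lambda>c. {a, c}) ` (- {a})" and ?B = "(\<lambda>c. {b, c}) ` (- {a, b})"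
    have "card (?A \<union> ?B) = card ?A + card ?B"
      using ab by (intro card_Un_disjoint) (auto simp: doubleton_eq_iff)
    also have "card ?A = CARD('n) - 1"
      by (subst card_image) (auto simp: inj_on_def doubleton_eq_iff Compl_eq_Diff_UNIV card_Diff_singleton)
    also have "card ?B = CARD('n) - 2"
      using ab by (subst card_image) (auto simp: inj_on_def doubleton_eq_iff Compl_eq_Diff_UNIV card_Diff_subset)
    finally have 1: "card (?A \<union> ?B) = (CARD('n) - 1) + (CARD('n) - 2)" .
    have "\<phi> ` (?A \<union> ?B) \<subseteq> (\<lambda>c. {\<sigma> a, c}) ` (- {\<sigma> a})"
    proof
      fix Z assume "Z \<in> \<phi> ` (?A \<union> ?B)"
      then obtain c where "Z = \<phi> {a, c} \<and> c \<noteq> a \<or> Z = \<phi> {b, c} \<and> c \<noteq> b" by auto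
      then have "card Z = 2" "\<sigma> a \<in> Z"
        using two[of "{a, c}"] two[of "{b, c}"] \<sigma>[of a c] \<sigma>[of b c] ab by auto
      then obtain c where "Z = {\<sigma> a, c}" "c \<noteq> \<sigma> a"
        by (metis card_2_iff insertE insert_commute singletonD)
      then show "Z \<in> (\<lambda>c. {\<sigma> a, c}) ` (- {\<sigma> a})" by auto
    qed
    then have "card (\<phi> ` (?A \<union> ?B)) \<le> card ((\<lambda>c. {\<sigma> a, c}) ` (- {\<sigma> a}))"
      by (intro card_mono) auto
    also have "\<dots> \<le> card (- {\<sigma> a})" by (rule card_image_le) simp
    also have "\<dots> = CARD('n) - 1" by (simp add: Compl_eq_Diff_UNIV card_Diff_singleton)
    finally have "card (\<phi> ` (?A \<union> ?B)) \<le> CARD('n) - 1" .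
    moreover have "card (\<phi> ` (?A \<union> ?B)) = card (?A \<union> ?B)"
      by (rule card_image, rule inj_on_subset[OF inj]) auto
    ultimately show False using 1 n by linarith
  qed
  moreover have "\<phi> A = \<sigma> ` A" if A: "card A = 2" for A
  proof -
    obtain a c where ac: "A = {a, c}" "a \<noteq> c" using A by (meson card_2_iff)
    then have "\<sigma> ` A \<subseteq> \<phi> A" using \<sigma>[of a c] \<sigma>[of c a] by (auto simp: insert_commute)
    moreover have "card (\<sigma> ` A) = 2" using A \<open>inj \<sigma>\<close> by (metis card_image inj_on_subset subset_UNIV)
    ultimately show ?thesis using two[OF A] by (metis card_subset_eq finite)
  qed
  ultimately have "bij \<sigma> \<and> (\<forall>A. card A = 2 \<longrightarrow> \<phi> A = \<sigma> ` A)"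
    by (simp add: bij_def finite_UNIV_inj_surj)
  then show ?thesis by blast
qed

section \<open>Graph distance and connectedness of the parity classes\<close>

lemma gdist_le_walk_length:
  assumes "pair_wf_digraph G" "pre_digraph.awalk (with_proj G) u p v"
  shows "gdist G u v \<le> ereal (length p)"
proof -
  interpret pair_wf_digraph G by fact
  have "gdist G u v \<le> ereal (awalk_cost (\<lambda>_. 1) p)"
    unfolding gdist_def \<mu>_def using assms(2) by (intro INF_lower) simp
  also have "awalk_cost (\<lambda>_. 1) p = length p"
    by (simp add: awalk_cost_def sum_list_triv)
  finally show ?thesis .
qed

lemma gdist_ge:
  assumes "pair_wf_digraph G" "\<And>p. pre_digraph.awalk (with_proj G) u p v \<Longrightarrow> length p \<ge> d"
  shows "gdist G u v \<ge> ereal d"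
proof -
  interpret pair_wf_digraph G by fact
  have "awalk_cost (\<lambda>_. 1) p = length p" for p
    by (simp add: awalk_cost_def sum_list_triv)
  then show ?thesis
    unfolding gdist_def \<mu>_def using assms(2) by (intro INF_greatest) auto
qed

text \<open>Distance is the least length of a walk: the first two conditions on the right exclude
  lengths 0 and 1, the third is a walk of length 2.\<close>

lemma gdist_eq_2_iff:
  assumes "pair_wf_digraph G"
  shows "gdist G u v = 2 \<longleftrightarrow>
    u \<noteq> v \<and> (u, v) \<notin> parcs G \<and> (\<exists>w. (u, w) \<in> parcs G \<and> (w, v) \<in> parcs G)" (is "?L \<longleftrightarrow> ?R")
proof -
  interpret pair_wf_digraph G by fact
  have walk0: "awalk u [] v \<longleftrightarrow> u \<in> pverts G \<and> u = v" for u v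
    by (auto simp: awalk_def)
  have walkS: "awalk u (e # p) v \<longleftrightarrow> (\<exists>w. e = (u, w) \<and> (u, w) \<in> parcs G \<and> awalk w p v)" for u v e p
    using in_arcsD1 in_arcsD2 by (cases e) (auto simp: awalk_def)
  show ?thesis
  proof
    assume L: ?L
    have ge2: "length p \<ge> 2" if "awalk u p v" for p
    proof -
      have "ereal 2 \<le> ereal (length p)"
        using gdist_le_walk_length[OF assms that] L by simp
      then show ?thesis by simp
    qed
    \<comment> \<open>If all walks had length at least 3, the infimum would be at least 3 as
      well.\<close>
    have "\<exists>p. awalk u p v \<and> \<not> 3 \<le> length p"
    proof (rule ccontr)
      assume "\<not> (\<exists>p. awalk u p v \<and> \<not> 3 \<le> length p)"
      then have "ereal (3::nat) \<le> gdist G u v" using gdist_ge[OF assms, of u v 3] by blast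
      then show False using L by simp
    qed
    then obtain p where p: "awalk u p v" "length p = 2" using ge2 by fastforce
    then obtain e e' where pe: "p = [e, e']" by (auto simp: numeral_2_eq_2 length_Suc_conv)
    then obtain w where w: "(u, w) \<in> parcs G" "(w, v) \<in> parcs G"
      using p(1) by (auto simp: walkS walk0)
    have "u \<noteq> v" using ge2[of "[]"] in_arcsD1[OF w(1)] walk0[of u v] by auto
    moreover have "(u, v) \<notin> parcs G"
      using ge2[of "[(u, v)]"] in_arcsD2[of u v] walk0[of v v] by (auto simp: walkS)
    ultimately show ?R using w by blast
  next
    assume R: ?R
    then obtain w where w: "(u, w) \<in> parcs G" "(w, v) \<in> parcs G" by blast
    have "awalk u [(u, w), (w, v)] v" using w in_arcsD2[OF w(2)] by (simp add: walkS walk0)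
    from gdist_le_walk_length[OF assms this] have "gdist G u v \<le> 2" by simp
    moreover have "gdist G u v \<ge> ereal (2::nat)"
    proof (rule gdist_ge[OF assms])
      fix p assume p: "awalk u p v"
      show "2 \<le> length p"
      proof (cases p)
        case Nil then show ?thesis using p R by (simp add: walk0)
      next
        case (Cons e q)
        then have "q \<noteq> []" using p R by (auto simp: walkS walk0)
        then show ?thesis using Cons by (cases q) auto
      qed
    qed
    ultimately show ?L by simp
  qed
qed

lemma cube_simps [simp]: "pverts cube = UNIV" "(v, w) \<in> parcs cube \<longleftrightarrow> hamming_dist v w = 1"
  by (simp_all add: cube_def)

lemma pair_wf_digraph_cube: "pair_wf_digraph cube"
  by unfold_locales auto

lemma flip_insert:
  assumes "i \<notin> S"
  shows "flip (insert i S) v = flip {i} (flip S v)"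
  using assms by (simp add: flip_flip)

text \<open>Flipping the differing coordinates one at a time is a walk. This direction turns a lower
  bound on graph distance, such as the one in d_K, into one on Hamming distance.\<close>

lemma gdist_cube_le: "gdist cube v w \<le> ereal (hamming_dist v w)"
proof -
  interpret pair_wf_digraph cube by (rule pair_wf_digraph_cube)
  have "\<exists>p. awalk v p (flip S v) \<and> length p = card S" for S
  proof (induction S rule: finite_induct[OF finite])
    case 1
    show ?case by (auto intro!: exI[of _ "[]"] simp: awalk_def)
  next
    case (2 i S)
    then obtain p where p: "awalk v p (flip S v)" "length p = card S" by blast
    have "hamming_dist (flip S v) (flip (insert i S) v) = 1"
      unfolding flip_insert[OF 2(2)] by simp
    then have "awalk (flip S v) [(flip S v, flip (insert i S) v)] (flip (insert i S) v)"
      by (simp add: awalk_def)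
    then have "awalk v (p @ [(flip S v, flip (insert i S) v)]) (flip (insert i S) v)"
      using p(1) by (rule awalk_appendI[rotated])
    then show ?case using p(2) 2 by (metis card_insert_disjoint length_append_singleton)
  qed
  then show ?thesis
    using gdist_le_walk_length[OF pair_wf_digraph_cube] by (metis flipE hamming_dist_flip)
qed

text \<open>Vectors of equal parity differ in an even set of coordinates, which can be flipped two
  at a time. This rule spreads local facts over a parity class.\<close>

lemma even_connected_induct:
  fixes v :: "bit ^ 'n"
  assumes v: "P v"
    and step: "\<And>x y. parity x = parity v \<Longrightarrow> hamming_dist x y = 2 \<Longrightarrow> P x \<Longrightarrow> P y"
    and w: "parity w = parity v"
  shows "P w"
proof -
  have "P (flip S v)" if "even (card S)" for S
    using that
  proof (induction "card S" arbitrary: S rule: less_induct)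
    case less
    show ?case
    proof (cases "S = {}")
      case False
      then obtain a where a: "a \<in> S" by blast
      have "S \<noteq> {a}" using less.prems by auto
      then obtain b where b: "b \<in> S" "b \<noteq> a" using a by blast
      \<comment> \<open>Peeling off \<open>a\<close> and \<open>b\<close> leaves an even set, whose
        flip is at distance 2 from that of \<open>S\<close>.\<close>
      let ?T = "S - {a, b}"
      have "card ?T = card S - 2" "card {a, b} \<le> card S"
        using a b card_mono[of S "{a, b}"] by (auto simp: card_Diff_subset)
      then have cS: "card S = card ?T + 2" using b(2) by simp
      then have "P (flip ?T v)" using less by auto
      moreover have "parity (flip ?T v) = parity v" using cS less.prems by (simp add: parity_flip)
      moreover have "sym_diff ?T S = {a, b}" using a b by auto
      then have "hamming_dist (flip ?T v) (flip S v) = 2"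
        using b by (simp add: hamming_dist_flip_flip)
      ultimately show ?thesis using step by blast
    qed (simp add: v)
  qed
  moreover obtain S where "w = flip S v" by (rule flipE)
  moreover have "even (card S)" using w calculation(2) by (auto simp: parity_flip)
  ultimately show ?thesis by simp
qed

section \<open>Orbits of a sparse even group and the halved graphs of the quotient\<close>

text \<open>The hypotheses on \<open>K\<close> in concrete form: composition and inverse of
  functions, and Hamming distance in place of graph distance.\<close>

locale sparse_even_group =
  fixes K :: "(bit ^ 'n \<Rightarrow> bit ^ 'n) set"
  assumes id_in: "id \<in> K"
    and comp_in: "\<And>k l. k \<in> K \<Longrightarrow> l \<in> K \<Longrightarrow> k \<circ> l \<in> K"
    and inv_in: "\<And>k. k \<in> K \<Longrightarrow> inv_into UNIV k \<in> K"
    and K_even: "K \<subseteq> even_cube_maps"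
    and sparse: "\<And>k v. k \<in> K \<Longrightarrow> k \<noteq> id \<Longrightarrow> hamming_dist v (k v) \<ge> 7"
begin

lemma orb_eq: "orb K v = (\<lambda>k. k v) ` K"
  by (auto simp: orb_def Group_Action.orbit_def)

lemma in_orb_self [simp]: "v \<in> orb K v"
  unfolding orb_eq using id_in by (metis id_apply imageI)

lemma orb_apply: "k \<in> K \<Longrightarrow> orb K (k v) = orb K v"
proof -
  assume k: "k \<in> K"
  have b: "bij k" using k K_even bij_even_cube_map by blast
  have "l (k v) \<in> orb K v" if "l \<in> K" for l
    using comp_in[OF that k] by (auto simp: orb_eq image_iff intro!: bexI[of _ "l \<circ> k"])
  moreover have "l v \<in> orb K (k v)" if "l \<in> K" for l
    using comp_in[OF that inv_in[OF k]] b
    by (auto simp: orb_eq image_iff bij_is_inj inv_f_f intro!: bexI[of _ "l \<circ> inv_into UNIV k"])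
  ultimately show ?thesis unfolding orb_eq by blast
qed

lemma orb_eq_iff: "orb K v = orb K w \<longleftrightarrow> (\<exists>k \<in> K. w = k v)"
  using orb_apply in_orb_self[of w] by (auto simp: orb_eq[of v])

lemma parity_orb: "orb K v = orb K w \<Longrightarrow> parity v = parity w"
  using K_even parity_even_cube_map by (metis orb_eq_iff subsetD)

text \<open>Only the identity of \<open>K\<close> moves a vector by less than 7. This is how
  sparsity enters the local arguments: two candidates for the same vector are shown to share an
  orbit and to be at distance at most 6.\<close>

lemma orb_inj:
  assumes "orb K v = orb K w" "hamming_dist v w < 7"
  shows "v = w"
  using assms sparse by (metis id_apply leD orb_eq_iff)

text \<open>Elements of \<open>K\<close> are isometries, so a pair realising a distance between two
  orbits can be moved to start at any chosen vector of the first. This is path lifting along the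
  orbit map.\<close>

lemma hamming_dist_lift:
  assumes "a \<in> orb K v" "b \<in> orb K w"
  shows "\<exists>w'. orb K w' = orb K w \<and> hamming_dist v w' = hamming_dist a b"
proof -
  obtain k where k: "k \<in> K" "a = k v" using assms(1) by (auto simp: orb_eq)
  then have "orb K v = orb K a" using orb_apply by simp
  then obtain l where l: "l \<in> K" "v = l a" by (metis orb_eq_iff)
  have "orb K (l b) = orb K w" using l(1) assms(2) orb_apply by (auto simp: orb_eq[of w])
  moreover have "hamming_dist v (l b) = hamming_dist a b" using l K_even by auto
  ultimately show ?thesis by blast
qed

lemma normal_quotient_arc_iff:
  "(orb K v, orb K w) \<in> parcs (normal_quotient cube K) \<longleftrightarrow>
     (\<exists>w'. orb K w' = orb K w \<and> hamming_dist v w' = 1)" (is "?L \<longleftrightarrow> ?R")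
proof
  assume ?L
  then obtain a b where "a \<in> orb K v" "b \<in> orb K w" "hamming_dist a b = 1"
    by (auto simp: normal_quotient_def)
  then show ?R using hamming_dist_lift by metis
next
  assume ?R
  then obtain w' where w': "orb K w' = orb K w" "hamming_dist v w' = 1" by blast
  \<comment> \<open>Adjacent vectors differ in parity while \<open>K\<close> preserves it, so the
    orbits are distinct, as an arc of the quotient requires.\<close>
  have "parity v \<noteq> parity w'" using w'(2) even_hamming_dist_iff[of v w'] by simp
  then have "orb K v \<noteq> orb K w" using parity_orb w'(1) by metis
  moreover have "w' \<in> orb K w" using w'(1) in_orb_self[of w'] by simp
  then have "\<exists>a \<in> orb K v. \<exists>b \<in> orb K w. hamming_dist a b = 1"
    using w'(2) in_orb_self by blast
  ultimately show ?L by (simp add: normal_quotient_def)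
qed

lemma pair_wf_digraph_normal_quotient: "pair_wf_digraph (normal_quotient cube K)"
  by unfold_locales (auto simp: normal_quotient_def)

lemma pverts_normal_quotient: "pverts (normal_quotient cube K) = range (orb K)"
  by (simp add: normal_quotient_def)

text \<open>Adjacency in a halved graph, stated in the cube for arbitrary sets so that invariance
  under isometries is immediate.\<close>

definition orbits_at_distance_2 :: "(bit ^ 'n) set \<Rightarrow> (bit ^ 'n) set \<Rightarrow> bool" where
  "orbits_at_distance_2 A B \<longleftrightarrow> (\<exists>a \<in> A. \<exists>b \<in> B. hamming_dist a b = 2)"

lemma orbits_at_distance_2_iff:
  "orbits_at_distance_2 (orb K v) (orb K w) \<longleftrightarrow> (\<exists>w'. orb K w' = orb K w \<and> hamming_dist v w' = 2)"
proof
  assume "orbits_at_distance_2 (orb K v) (orb K w)"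
  then obtain a b where "a \<in> orb K v" "b \<in> orb K w" "hamming_dist a b = 2"
    unfolding orbits_at_distance_2_def by blast
  then show "\<exists>w'. orb K w' = orb K w \<and> hamming_dist v w' = 2" using hamming_dist_lift by metis
next
  assume "\<exists>w'. orb K w' = orb K w \<and> hamming_dist v w' = 2"
  then show "orbits_at_distance_2 (orb K v) (orb K w)"
    unfolding orbits_at_distance_2_def using in_orb_self by blast
qed

text \<open>A path of length 2 in the quotient lifts to one in the cube starting at
  \<open>v\<close>; its end is at even distance at most 2, and not 0 since the orbits differ.
  Conversely a cube path of length 2 projects; sparsity keeps its end orbits distinct and parity
  keeps them nonadjacent.\<close>

lemma gdist_normal_quotient_eq_2_iff:
  "gdist (normal_quotient cube K) (orb K v) (orb K w) = 2 \<longleftrightarrow>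
     orbits_at_distance_2 (orb K v) (orb K w)" (is "?L \<longleftrightarrow> ?R")
proof
  assume L: ?L
  then obtain C where C: "(orb K v, C) \<in> parcs (normal_quotient cube K)"
    "(C, orb K w) \<in> parcs (normal_quotient cube K)" and ne: "orb K v \<noteq> orb K w"
    unfolding gdist_eq_2_iff[OF pair_wf_digraph_normal_quotient] by blast
  then obtain u where u: "C = orb K u" by (auto simp: normal_quotient_def)
  obtain u' where u': "orb K u' = orb K u" "hamming_dist v u' = 1"
    using C(1) unfolding u normal_quotient_arc_iff by blast
  then obtain w' where w': "orb K w' = orb K w" "hamming_dist u' w' = 1"
    using C(2) unfolding u by (metis normal_quotient_arc_iff)
  have "hamming_dist v w' \<le> 2" using hamming_dist_triangle[of v w' u'] u' w' by simp
  moreover have "even (hamming_dist v w')"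
    using u' w' even_hamming_dist_iff[of v u'] even_hamming_dist_iff[of u' w'] even_hamming_dist_iff[of v w'] by auto
  moreover have "hamming_dist v w' \<noteq> 0" using ne w' by auto
  ultimately have "hamming_dist v w' = 2" by presburger
  then show ?R using w'(1) orbits_at_distance_2_iff by blast
next
  assume ?R
  then obtain w' where w': "orb K w' = orb K w" "hamming_dist v w' = 2"
    using orbits_at_distance_2_iff by blast
  obtain S where S: "card S = 2" "w' = flip S v" using w'(2) by (rule hamming_distE)
  obtain a b where ab: "S = {a, b}" "a \<noteq> b" using S(1) by (meson card_2_iff)
  have "hamming_dist v (flip {a} v) = 1" by simp
  moreover have "hamming_dist (flip {a} v) w' = 1"
  proof -
    have "sym_diff {a} S = {b}" using ab by auto
    then show ?thesis by (simp add: S(2) hamming_dist_flip_flip)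
  qed
  moreover have "orb K v \<noteq> orb K w" using orb_inj[of v w'] w' by auto
  moreover have "(orb K v, orb K w) \<notin> parcs (normal_quotient cube K)"
  proof
    assume "(orb K v, orb K w) \<in> parcs (normal_quotient cube K)"
    then obtain w'' where "orb K w'' = orb K w" "hamming_dist v w'' = 1"
      using normal_quotient_arc_iff by blast
    then show False
      using w' parity_orb[of w' w''] even_hamming_dist_iff[of v w'] even_hamming_dist_iff[of v w''] by simp
  qed
  ultimately show ?L
    unfolding gdist_eq_2_iff[OF pair_wf_digraph_normal_quotient] using w'(1)
    by (metis normal_quotient_arc_iff)
qed

lemma distance2_arc_iff:
  "(orb K v, orb K w) \<in> parcs (distance2_graph (normal_quotient cube K)) \<longleftrightarrow>
     orbits_at_distance_2 (orb K v) (orb K w)"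
  using gdist_normal_quotient_eq_2_iff[of v w]
  by (simp add: distance2_graph_def pverts_normal_quotient)

lemma pair_wf_digraph_distance2: "pair_wf_digraph (distance2_graph (normal_quotient cube K))"
  by unfold_locales (auto simp: distance2_graph_def)

lemma orbits_at_distance_2_parity:
  assumes "orbits_at_distance_2 (orb K v) (orb K w)"
  shows "parity v = parity w"
proof -
  obtain w' where "orb K w' = orb K w" "hamming_dist v w' = 2"
    using assms orbits_at_distance_2_iff by blast
  then show ?thesis using parity_orb[of w' w] even_hamming_dist_iff[of v w'] by simp
qed

definition half_orbits :: "bool \<Rightarrow> (bit ^ 'n) set set" where
  "half_orbits p = orb K ` {v. parity v = p}"

lemma orb_in_half_orbits_iff: "orb K v \<in> half_orbits p \<longleftrightarrow> parity v = p"
  unfolding half_orbits_def using parity_orb[of v] by blast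

text \<open>Steps at distance 2 preserve parity, and \<open>even_connected_induct\<close> joins all
  vectors of one parity by such steps; so the component of \<open>orb K v\<close> consists of the
  orbits with the parity of \<open>v\<close>.\<close>

lemma halved_graph_normal_quotient:
  assumes "\<Gamma> \<in> halved_graphs (normal_quotient cube K)"
  shows "\<exists>p. verts \<Gamma> = half_orbits p \<and>
    (\<forall>A \<in> verts \<Gamma>. \<forall>B \<in> verts \<Gamma>. A \<rightarrow>\<^bsub>\<Gamma>\<^esub> B \<longleftrightarrow> orbits_at_distance_2 A B)"
proof -
  let ?D = "distance2_graph (normal_quotient cube K)"
  interpret pair_wf_digraph ?D by (rule pair_wf_digraph_distance2)
  have ind: "induced_subgraph \<Gamma> ?D" and "verts \<Gamma> \<in> sccs_verts"
    using assms in_sccs_vertsI_sccs by (auto simp: halved_graphs_def)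
  then have ne: "verts \<Gamma> \<noteq> {}"
    and conn: "\<And>A B. A \<in> verts \<Gamma> \<Longrightarrow> B \<in> verts \<Gamma> \<Longrightarrow> A \<rightarrow>\<^sup>*\<^bsub>?D\<^esub> B"
    and closed: "\<And>A B. A \<in> verts \<Gamma> \<Longrightarrow> A \<rightarrow>\<^sup>*\<^bsub>?D\<^esub> B \<Longrightarrow> B \<rightarrow>\<^sup>*\<^bsub>?D\<^esub> A \<Longrightarrow> B \<in> verts \<Gamma>"
    unfolding in_sccs_verts_conv_reachable by blast+
  have vD: "pverts ?D = range (orb K)"
    by (simp add: distance2_graph_def pverts_normal_quotient)
  have sub: "verts \<Gamma> \<subseteq> range (orb K)" and arcs: "arcs \<Gamma> = {e \<in> parcs ?D. fst e \<in> verts \<Gamma> \<and> snd e \<in> verts \<Gamma>}"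
    and ends: "tail \<Gamma> = fst" "head \<Gamma> = snd"
    using ind by (auto simp: induced_subgraph_def subgraph_def compatible_def vD)
  obtain v where v: "orb K v \<in> verts \<Gamma>" using ne sub by blast
  have reach: "orb K w \<rightarrow>\<^sup>*\<^bsub>?D\<^esub> orb K u" if "parity u = parity w" for u w
  proof (rule even_connected_induct[of "\<lambda>u. orb K w \<rightarrow>\<^sup>*\<^bsub>?D\<^esub> orb K u" w])
    fix x y assume xy: "orb K w \<rightarrow>\<^sup>*\<^bsub>?D\<^esub> orb K x" "hamming_dist x y = 2"
    have "(orb K x, orb K y) \<in> parcs ?D"
      using xy(2) distance2_arc_iff[of x y] orbits_at_distance_2_iff[of x y] by auto
    with xy(1) show "orb K w \<rightarrow>\<^sup>*\<^bsub>?D\<^esub> orb K y" by (rule reachable_adj_trans)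
  qed (use that vD in auto)
  have par: "B \<in> half_orbits (parity v)" if "orb K v \<rightarrow>\<^sup>*\<^bsub>?D\<^esub> B" for B
    using that
  proof (induction rule: reachable_induct)
    case base then show ?case by (simp add: orb_in_half_orbits_iff)
  next
    case (step A B)
    then have B: "(A, B) \<in> parcs ?D" by simp
    obtain a where a: "A = orb K a" "parity a = parity v"
      using step.IH by (auto simp: half_orbits_def)
    obtain b where b: "B = orb K b" using B by (auto simp: distance2_graph_def pverts_normal_quotient)
    show ?case
      using B orbits_at_distance_2_parity[of a b] a(2) unfolding a(1) b distance2_arc_iff orb_in_half_orbits_iff
      by simp
  qed
  have "verts \<Gamma> = half_orbits (parity v)"
  proof
    show "verts \<Gamma> \<subseteq> half_orbits (parity v)" using conn v par by blast
    show "half_orbits (parity v) \<subseteq> verts \<Gamma>"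
      using closed[OF v] reach by (auto simp: half_orbits_def)
  qed
  moreover have "A \<rightarrow>\<^bsub>\<Gamma>\<^esub> B \<longleftrightarrow> orbits_at_distance_2 A B" if AB: "A \<in> verts \<Gamma>" "B \<in> verts \<Gamma>" for A B
  proof -
    have "A \<rightarrow>\<^bsub>\<Gamma>\<^esub> B \<longleftrightarrow> (A, B) \<in> parcs ?D"
      using AB by (auto simp: arcs_ends_conv arcs ends image_iff)
    moreover obtain a b where "A = orb K a" "B = orb K b" using AB sub by blast
    ultimately show ?thesis using distance2_arc_iff by simp
  qed
  ultimately show ?thesis by blast
qed

end

section \<open>Rigidity of even cube maps\<close>

text \<open>For the permutations \<open>\<sigma>\<close>, \<open>\<tau>\<close> of \<open>g\<close>,
  \<open>h\<close>, agreement gives \<open>{\<sigma> i, \<sigma> k} = {\<tau> i, \<tau> k}\<close>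
  whenever \<open>k \<noteq> i\<close>. Two different such \<open>k\<close> show
  \<open>\<sigma> i = \<tau> i\<close>, the common element, and the rest follows. The pairs through
  one \<open>i\<close> are available in the overlap of two adjacent balls.\<close>

lemma even_cube_map_eqI:
  fixes g h :: "bit ^ 'n \<Rightarrow> bit ^ 'n"
  assumes "CARD('n) \<ge> 3" "g \<in> even_cube_maps" "h \<in> even_cube_maps" "g v = h v"
    and pairs: "\<And>k. k \<noteq> i \<Longrightarrow> g (flip {i, k} v) = h (flip {i, k} v)"
  shows "g = h"
proof -
  obtain \<sigma> where s: "bij \<sigma>" "\<And>S v. g (flip S v) = flip (\<sigma> ` S) (g v)"
    using assms(2) even_cube_mapE by blast
  obtain \<tau> where t: "bij \<tau>" "\<And>S v. h (flip S v) = flip (\<tau> ` S) (h v)"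
    using assms(3) even_cube_mapE by blast
  have eq: "{\<sigma> i, \<sigma> k} = {\<tau> i, \<tau> k}" if "k \<noteq> i" for k
    using pairs[OF that] assms(4) by (simp add: s(2) t(2))
  have "card (- {i}) \<ge> 2" using assms(1) by (simp add: Compl_eq_Diff_UNIV card_Diff_singleton)
  then obtain T where "T \<subseteq> - {i}" "card T = 2" by (meson obtain_subset_with_card_n)
  moreover from this obtain k l where "T = {k, l}" "k \<noteq> l" by (meson card_2_iff)
  ultimately have kl: "k \<noteq> i" "l \<noteq> i" "k \<noteq> l" by auto
  have "\<tau> k \<noteq> \<tau> l" using t(1) kl(3) by (meson bij_is_inj injD)
  then have "\<sigma> i = \<tau> i" using eq[OF kl(1)] eq[OF kl(2)] by (auto simp: doubleton_eq_iff)
  then have "\<sigma> k = \<tau> k" for k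
    using eq[of k] by (cases "k = i") (auto simp: doubleton_eq_iff)
  then have "g (flip S v) = h (flip S v)" for S
    by (simp add: s(2) t(2) assms(4))
  then show ?thesis by (metis ext flipE)
qed

lemma ex_parity: "\<exists>v :: bit ^ 'n. parity v = p"
proof
  \<comment> \<open>\<open>undefined\<close> is an arbitrary coordinate; flipping it changes the
    parity of 0.\<close>
  show "parity (flip (if parity (0 :: bit ^ 'n) = p then {} else {undefined}) (0 :: bit ^ 'n)) = p"
    by (auto simp: parity_flip)
qed

lemma parity_flip_pair: "i \<noteq> k \<Longrightarrow> parity (flip {i, k} v) = parity v"
  by (simp add: parity_flip)

context sparse_even_group
begin

text \<open>The \<open>k\<close> that agrees with \<open>g\<close> at one vector serves for its
  whole parity class: if \<open>g x = k x\<close> and \<open>y\<close> is at distance 2 from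
  \<open>x\<close>, then \<open>g y\<close> and \<open>k y\<close> share an orbit and are at
  distance at most 4.\<close>

lemma fixes_half_orbits_imp_mem:
  assumes "CARD('n) \<ge> 3" "g \<in> even_cube_maps"
    and fixed: "\<And>v. parity v = p \<Longrightarrow> orb K (g v) = orb K v"
  shows "g \<in> K"
proof -
  obtain v :: "bit ^ 'n" where v: "parity v = p" using ex_parity by blast
  obtain k where k: "k \<in> K" "g v = k v"
    using fixed[OF v] by (metis orb_eq_iff)
  then have kE: "k \<in> even_cube_maps" using K_even by blast
  have agree: "g w = k w" if "parity w = parity v" for w
  proof (rule even_connected_induct[of "\<lambda>w. g w = k w" v, OF k(2) _ that])
    fix x y assume xy: "parity x = parity v" "hamming_dist x y = 2" "g x = k x"
    have "parity y = p" using xy even_hamming_dist_iff[of x y] v by simp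
    then have "orb K (g y) = orb K (k y)" using fixed orb_apply[OF k(1)] by simp
    moreover have "hamming_dist (g y) (k y) \<le> hamming_dist (g y) (g x) + hamming_dist (k x) (k y)"
      using hamming_dist_triangle[of "g y" "k y" "g x"] xy(3) by simp
    then have "hamming_dist (g y) (k y) < 7"
      using xy(2) hamming_dist_commute[of x y] by (simp add: assms(2) kE)
    ultimately show "g y = k y" by (rule orb_inj)
  qed
  \<comment> \<open>Flips of pairs preserve parity, so agreement on one class suffices;
    \<open>undefined\<close> is an arbitrary coordinate.\<close>
  have "g = k"
    by (rule even_cube_map_eqI[OF assms(1,2) kE k(2), of undefined]) (simp add: agree parity_flip_pair)
  then show ?thesis using k(1) by simp
qed

section \<open>Lifting an automorphism of a halved graph\<close>

context
  fixes f :: "(bit ^ 'n) set \<Rightarrow> (bit ^ 'n) set" and p :: bool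
  assumes n: "CARD('n) \<ge> 5"
    and f_bij: "bij_betw f (half_orbits p) (half_orbits p)"
    and f_adj: "\<And>A B. A \<in> half_orbits p \<Longrightarrow> B \<in> half_orbits p \<Longrightarrow>
      orbits_at_distance_2 (f A) (f B) \<longleftrightarrow> orbits_at_distance_2 A B"
begin

text \<open>Distance 1 is left out: it leads to the other parity class, whose orbits are not
  vertices of the halved graph.\<close>

definition lifts_near :: "(bit ^ 'n \<Rightarrow> bit ^ 'n) \<Rightarrow> bit ^ 'n \<Rightarrow> bool" where
  "lifts_near g x \<longleftrightarrow> (\<forall>w. hamming_dist x w \<in> {0, 2} \<longrightarrow> f (orb K w) = orb K (g w))"

lemma f_orb_inj:
  assumes "parity v = p" "parity w = p" "f (orb K v) = f (orb K w)" "hamming_dist v w < 7"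
  shows "v = w"
proof -
  have "orb K v = orb K w"
    using f_bij assms(1-3) by (simp add: bij_betw_def inj_on_def orb_in_half_orbits_iff)
  then show ?thesis using assms(4) by (rule orb_inj)
qed

text \<open>Adjacency of the image orbits is lifted to the chosen representative
  \<open>y\<close>.\<close>

lemma f_orb_neighbour:
  assumes "parity v = p" "hamming_dist v w = 2" "f (orb K v) = orb K y"
  obtains z where "f (orb K w) = orb K z" "hamming_dist y z = 2"
proof -
  have w: "parity w = p" using assms even_hamming_dist_iff[of v w] by simp
  then have "f (orb K w) \<in> half_orbits p"
    using f_bij by (meson bij_betwE orb_in_half_orbits_iff)
  then obtain u where u: "f (orb K w) = orb K u" by (auto simp: half_orbits_def)
  have "orbits_at_distance_2 (orb K v) (orb K w)"
    using assms(2) orbits_at_distance_2_iff by blast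
  then have "orbits_at_distance_2 (orb K y) (orb K u)"
    using f_adj[of "orb K v" "orb K w"] assms(1) w u assms(3) by (simp add: orb_in_half_orbits_iff)
  then obtain z where "orb K z = orb K u" "hamming_dist y z = 2"
    using orbits_at_distance_2_iff by blast
  then show ?thesis using that[of z] u by simp
qed

text \<open>With \<open>x\<close> and \<open>y\<close> as origins, \<open>f\<close> induces a map
  \<open>\<phi>\<close> on pairs. Pairs meeting in one point give vectors at distance 2, so
  \<open>\<phi>\<close> preserves such meetings and comes from a permutation
  \<open>\<sigma>\<close>; the lift sends \<open>x\<close> to \<open>y\<close> with permutation
  \<open>\<sigma>\<close>. The representative \<open>y\<close> is left free so that lifts at
  adjacent vectors can be matched.\<close>

lemma ex_local_lift:
  assumes x: "parity x = p" and y: "f (orb K x) = orb K y"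
  shows "\<exists>g \<in> even_cube_maps. g x = y \<and> lifts_near g x"
proof -
  have "\<exists>B. card B = 2 \<and> f (orb K (flip A x)) = orb K (flip B y)" if A: "card A = 2" for A
  proof -
    obtain z where "f (orb K (flip A x)) = orb K z" "hamming_dist y z = 2"
      by (rule f_orb_neighbour[OF x _ y, of "flip A x"]) (simp add: A)
    then show ?thesis by (metis hamming_distE)
  qed
  then obtain \<phi> where \<phi>: "\<And>A. card A = 2 \<Longrightarrow> card (\<phi> A) = 2"
    "\<And>A. card A = 2 \<Longrightarrow> f (orb K (flip A x)) = orb K (flip (\<phi> A) y)"
    by metis
  have par: "parity (flip A x) = p" if "card A = 2" for A
    using that x by (simp add: parity_flip)
  have close: "hamming_dist (flip A v) (flip B v) \<le> 4" if "card A = 2" "card B = 2" for A B and v :: "bit ^ 'n"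
    using card_sym_diff_Int[of A B] that by (simp add: hamming_dist_flip_flip)
  have "\<exists>\<sigma>. bij \<sigma> \<and> (\<forall>A. card A = 2 \<longrightarrow> \<phi> A = \<sigma> ` A)"
  proof (rule triangular_graph_automorphism[OF n \<phi>(1)])
    show "inj_on \<phi> {A. card A = 2}"
    proof (rule inj_onI)
      fix A B assume AB: "A \<in> {A. card A = 2}" "B \<in> {A. card A = 2}" "\<phi> A = \<phi> B"
      then have "flip A x = flip B x"
        using \<phi>(2)[of A] \<phi>(2)[of B] close[of A B x] by (intro f_orb_inj) (auto simp: par)
      then show "A = B" by simp
    qed
    show "card (\<phi> A \<inter> \<phi> B) = 1" if AB: "card A = 2" "card B = 2" "card (A \<inter> B) = 1" for A B
    proof -
      have "hamming_dist (flip A x) (flip B x) = 2"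
        using card_sym_diff_Int[of A B] AB by (simp add: hamming_dist_flip_flip)
      then obtain z where z: "f (orb K (flip B x)) = orb K z" "hamming_dist (flip (\<phi> A) y) z = 2"
        using f_orb_neighbour[OF par[OF AB(1)] _ \<phi>(2)[OF AB(1)]] by blast
      \<comment> \<open>Adjacency only gives some \<open>z\<close> in the right orbit at distance 2
        from \<open>flip (\<phi> A) y\<close>. It is within 2 + 4 = 6 of
        \<open>flip (\<phi> B) y\<close>, so the bound 7 identifies the two.\<close>
      have "z = flip (\<phi> B) y"
      proof (rule orb_inj)
        show "orb K z = orb K (flip (\<phi> B) y)" using z(1) \<phi>(2)[OF AB(2)] by simp
        show "hamming_dist z (flip (\<phi> B) y) < 7"
          using hamming_dist_triangle[of z "flip (\<phi> B) y" "flip (\<phi> A) y"]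
            hamming_dist_commute[of z "flip (\<phi> A) y"] z(2) close[OF \<phi>(1)[OF AB(1)] \<phi>(1)[OF AB(2)], of y]
          by simp
      qed
      then have "card (sym_diff (\<phi> A) (\<phi> B)) = 2" using z(2) by (simp add: hamming_dist_flip_flip)
      then show ?thesis
        using card_sym_diff_Int[of "\<phi> A" "\<phi> B"] \<phi>(1)[OF AB(1)] \<phi>(1)[OF AB(2)] by simp
    qed
  qed
  then obtain \<sigma> where \<sigma>: "bij \<sigma>" "\<And>A. card A = 2 \<Longrightarrow> \<phi> A = \<sigma> ` A" by blast
  have "orb K y \<in> half_orbits p"
    using f_bij y x by (metis bij_betwE orb_in_half_orbits_iff)
  then have "parity x = parity y" using x by (simp add: orb_in_half_orbits_iff)
  then obtain g where g: "g \<in> even_cube_maps" "\<And>S. g (flip S x) = flip (\<sigma> ` S) y"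
    using ex_even_cube_map[OF _ \<sigma>(1)] by blast
  have gx: "g x = y" using g(2)[of "{}"] by simp
  moreover have "lifts_near g x"
    unfolding lifts_near_def
  proof (intro allI impI)
    fix w assume w: "hamming_dist x w \<in> {0, 2}"
    obtain S where S: "w = flip S x" by (rule flipE)
    show "f (orb K w) = orb K (g w)"
      using w S gx y g(2)[of S] \<phi>(2)[of S] \<sigma>(2)[of S] by auto
  qed
  ultimately show ?thesis using g(1) by blast
qed

text \<open>The neighbours that \<open>x\<close> and \<open>y\<close> have in common determine an even cube map, and on these
  both lifts take values in the ball of radius 2 around the common image of \<open>y\<close>.\<close>

lemma local_lifts_agree:
  assumes "g \<in> even_cube_maps" "h \<in> even_cube_maps" "lifts_near g x" "lifts_near h y"
    and "hamming_dist x y = 2" "g y = h y"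
  shows "g = h"
proof -
  obtain S where S: "card S = 2" "y = flip S x" using assms(5) by (rule hamming_distE)
  obtain i j where ij: "S = {i, j}" "i \<noteq> j" using S(1) by (meson card_2_iff)
  show ?thesis
  proof (rule even_cube_map_eqI[OF _ assms(1,2,6), of i])
    fix k assume k: "k \<noteq> i"
    let ?w = "flip {i, k} y"
    \<comment> \<open>For \<open>k = j\<close> the neighbour of \<open>y\<close> is \<open>x\<close>
      itself; otherwise the two flips of \<open>i\<close> cancel.\<close>
    have "hamming_dist x ?w \<in> {0, 2}"
    proof (cases "k = j")
      case True then show ?thesis using S ij by simp
    next
      case False
      have "sym_diff {i, k} {i, j} = {j, k}" using ij k False by auto
      then have "?w = flip {j, k} x" by (simp add: S(2) ij flip_flip)
      then show ?thesis using False by auto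
    qed
    then have "f (orb K ?w) = orb K (g ?w)" using assms(3) unfolding lifts_near_def by blast
    moreover have y_w: "hamming_dist y ?w = 2" using k by simp
    then have "f (orb K ?w) = orb K (h ?w)" using assms(4) unfolding lifts_near_def by blast
    moreover have "hamming_dist (g ?w) (h ?w) < 7"
    proof -
      have "hamming_dist (g ?w) (h ?w) \<le> hamming_dist (g ?w) (g y) + hamming_dist (h y) (h ?w)"
        using hamming_dist_triangle[of "g ?w" "h ?w" "g y"] assms(6) by simp
      also have "\<dots> = hamming_dist ?w y + hamming_dist y ?w" using assms(1,2) by simp
      also have "\<dots> = 4" using y_w hamming_dist_commute[of ?w y] by simp
      finally show ?thesis by simp
    qed
    ultimately show "g ?w = h ?w" using orb_inj by simp
  qed (use n in simp)
qed

text \<open>A local lift at one vector is continued along steps of distance 2: the local lift at the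
  next vector turns out to be the same map.\<close>

lemma ex_lift: "\<exists>g \<in> even_cube_maps. \<forall>v. parity v = p \<longrightarrow> f (orb K v) = orb K (g v)"
proof -
  obtain v :: "bit ^ 'n" where v: "parity v = p" using ex_parity by blast
  have "f (orb K v) \<in> half_orbits p"
    using f_bij v by (metis bij_betwE orb_in_half_orbits_iff)
  then obtain y where "f (orb K v) = orb K y" by (auto simp: half_orbits_def)
  then obtain g where g: "g \<in> even_cube_maps" "lifts_near g v" using ex_local_lift[OF v] by blast
  have near: "lifts_near g w" if "parity w = parity v" for w
  proof (rule even_connected_induct[of "lifts_near g" v, OF g(2) _ that])
    fix x y assume xy: "parity x = parity v" "hamming_dist x y = 2" "lifts_near g x"
    have "f (orb K y) = orb K (g y)" using xy(2,3) by (simp add: lifts_near_def)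
    moreover have "parity y = p" using xy v even_hamming_dist_iff[of x y] by simp
    \<comment> \<open>The value of the new lift at \<open>y\<close> is prescribed to be
      \<open>g y\<close>, which makes the two lifts comparable.\<close>
    ultimately obtain h where h: "h \<in> even_cube_maps" "h y = g y" "lifts_near h y"
      using ex_local_lift by blast
    have "g = h" by (rule local_lifts_agree[OF g(1) h(1) xy(3) h(3) xy(2)]) (simp add: h(2))
    then show "lifts_near g y" using h(3) by simp
  qed
  have "f (orb K w) = orb K (g w)" if "parity w = p" for w
  proof -
    have "lifts_near g w" using near that v by simp
    then show ?thesis unfolding lifts_near_def by simp
  qed
  then show ?thesis using g(1) by blast
qed

text \<open>Both conjugates of \<open>k\<close> fix every orbit of parity \<open>p\<close>, because
  \<open>k\<close> fixes orbits and \<open>g\<close> induces \<open>f\<close> on them.\<close>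

lemma lift_normalizes:
  assumes g: "g \<in> even_cube_maps" and lift: "\<And>v. parity v = p \<Longrightarrow> f (orb K v) = orb K (g v)"
    and k: "k \<in> K"
  shows "g \<circ> k \<circ> inv_into UNIV g \<in> K" "inv_into UNIV g \<circ> k \<circ> g \<in> K"
proof -
  let ?h = "inv_into UNIV g"
  have h: "?h \<in> even_cube_maps" using g by (rule even_cube_maps_inv)
  have gh: "g (?h v) = v" for v using bij_even_cube_map[OF g] by (simp add: bij_is_surj surj_f_inv_f)
  have kE: "k \<in> even_cube_maps" using k K_even by blast
  have n3: "CARD('n) \<ge> 3" using n by simp
  show "g \<circ> k \<circ> ?h \<in> K"
  proof (rule fixes_half_orbits_imp_mem[OF n3, of _ p])
    show "g \<circ> k \<circ> ?h \<in> even_cube_maps" by (intro even_cube_maps_comp g h kE)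
    fix v :: "bit ^ 'n" assume v: "parity v = p"
    have "orb K (g (k (?h v))) = f (orb K (k (?h v)))"
      using v by (simp add: lift parity_even_cube_map kE h)
    also have "\<dots> = f (orb K (?h v))" by (simp add: orb_apply k)
    also have "\<dots> = orb K v" using v by (simp add: lift parity_even_cube_map h gh)
    finally show "orb K ((g \<circ> k \<circ> ?h) v) = orb K v" by simp
  qed
  show "?h \<circ> k \<circ> g \<in> K"
  proof (rule fixes_half_orbits_imp_mem[OF n3, of _ p])
    show "?h \<circ> k \<circ> g \<in> even_cube_maps" by (intro even_cube_maps_comp g h kE)
    fix v :: "bit ^ 'n" assume v: "parity v = p"
    have par: "parity (?h (k (g v))) = p" using v by (simp add: parity_even_cube_map kE h g)
    have "f (orb K (?h (k (g v)))) = orb K (k (g v))" by (simp add: lift par gh)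
    also have "\<dots> = f (orb K v)" by (simp add: orb_apply k lift v)
    \<comment> \<open>Here \<open>f\<close> itself is cancelled, being injective on the orbits of
      parity \<open>p\<close>.\<close>
    finally have "orb K (?h (k (g v))) = orb K v"
      using f_bij par v by (simp add: bij_betw_def inj_on_def orb_in_half_orbits_iff)
    then show "orb K ((?h \<circ> k \<circ> g) v) = orb K v" by simp
  qed
qed

end

end

section \<open>Permutation groups, normalizers and the concrete form of the hypotheses\<close>

lemma Bij_UNIV: "Bij UNIV = {f. bij f}"
  by (auto simp: Bij_def extensional_def)

lemma BijGroup_simps:
  "carrier (BijGroup S) = Bij S"
  "f \<in> Bij S \<Longrightarrow> g \<in> Bij S \<Longrightarrow> f \<otimes>\<^bsub>BijGroup S\<^esub> g = compose S f g"
  "\<one>\<^bsub>BijGroup S\<^esub> = (\<lambda>x \<in> S. x)"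
  by (auto simp: BijGroup_def)

lemma inv_BijGroup:
  assumes "f \<in> Bij S"
  shows "inv\<^bsub>BijGroup S\<^esub> f = (\<lambda>x \<in> S. inv_into S f x)"
proof -
  interpret group "BijGroup S" by (rule group_BijGroup)
  show ?thesis
    by (rule inv_equality)
      (use assms in \<open>simp_all add: BijGroup_simps restrict_inv_into_Bij Bij_compose_restrict_eq\<close>)
qed

lemma subgroup_automorphisms:
  "subgroup {f \<in> Bij (verts G). \<forall>u \<in> verts G. \<forall>v \<in> verts G. (f u \<rightarrow>\<^bsub>G\<^esub> f v) \<longleftrightarrow> (u \<rightarrow>\<^bsub>G\<^esub> v)}
     (BijGroup (verts G))" (is "subgroup ?A _")
proof (rule group.subgroupI[OF group_BijGroup])
  show "?A \<subseteq> carrier (BijGroup (verts G))" by (auto simp: BijGroup_simps)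
  show "?A \<noteq> {}" using id_Bij[of "verts G"] by (auto intro!: exI[of _ "\<lambda>x \<in> verts G. x"])
  fix f assume f: "f \<in> ?A"
  let ?h = "inv_into (verts G) f"
  have b: "bij_betw f (verts G) (verts G)" using f by (simp add: Bij_def)
  have h: "?h u \<in> verts G" "f (?h u) = u" if "u \<in> verts G" for u
    using that b by (auto simp: bij_betw_def inv_into_into f_inv_into_f)
  have "(?h u \<rightarrow>\<^bsub>G\<^esub> ?h v) \<longleftrightarrow> (u \<rightarrow>\<^bsub>G\<^esub> v)" if "u \<in> verts G" "v \<in> verts G" for u v
  proof -
    have "(f (?h u) \<rightarrow>\<^bsub>G\<^esub> f (?h v)) \<longleftrightarrow> (?h u \<rightarrow>\<^bsub>G\<^esub> ?h v)"
      using f h(1)[OF that(1)] h(1)[OF that(2)] by blast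
    then show ?thesis using h(2) that by simp
  qed
  then show "inv\<^bsub>BijGroup (verts G)\<^esub> f \<in> ?A"
    using f by (simp add: inv_BijGroup restrict_inv_into_Bij)
next
  fix f g assume fg: "f \<in> ?A" "g \<in> ?A"
  have "g u \<in> verts G" if "u \<in> verts G" for u using fg(2) that Bij_imp_funcset by blast
  then show "f \<otimes>\<^bsub>BijGroup (verts G)\<^esub> g \<in> ?A"
    using fg by (simp add: BijGroup_simps compose_Bij compose_eq)
qed

lemma group_aut_group: "group (aut_group G)"
  unfolding aut_group_def by (rule subgroup.subgroup_is_group[OF subgroup_automorphisms group_BijGroup])

text \<open>Forming \<open>aut_group\<close> changes the carrier alone, so the group laws can be
  checked in the full symmetric group on the vectors.\<close>

lemma even_cube_group_eq: "even_cube_group = (BijGroup UNIV)\<lparr>carrier := even_cube_maps\<rparr>"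
  by (simp add: even_cube_group_def aut_group_def)

lemma subgroup_even_cube_maps: "subgroup even_cube_maps (BijGroup UNIV)"
proof (rule group.subgroupI[OF group_BijGroup])
  show "even_cube_maps \<subseteq> carrier (BijGroup UNIV)"
    by (auto simp: BijGroup_simps Bij_UNIV bij_even_cube_map)
  show "even_cube_maps \<noteq> {}" using even_cube_maps_id by blast
  fix g h :: "bit ^ 'n \<Rightarrow> bit ^ 'n"
  assume g: "g \<in> even_cube_maps"
  show "inv\<^bsub>BijGroup UNIV\<^esub> g \<in> even_cube_maps"
    using even_cube_maps_inv[OF g] bij_even_cube_map[OF g] by (simp add: inv_BijGroup Bij_UNIV restrict_UNIV)
  assume h: "h \<in> even_cube_maps"
  show "g \<otimes>\<^bsub>BijGroup UNIV\<^esub> h \<in> even_cube_maps"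
    using even_cube_maps_comp[OF g h] bij_even_cube_map[OF g] bij_even_cube_map[OF h]
    by (simp add: BijGroup_simps Bij_UNIV compose_def restrict_UNIV comp_def)
qed

lemma group_even_cube_group: "group even_cube_group"
  unfolding even_cube_group_eq by (rule subgroup.subgroup_is_group[OF subgroup_even_cube_maps group_BijGroup])

lemma carrier_even_cube_group [simp]: "carrier even_cube_group = even_cube_maps"
  by (simp add: even_cube_group_eq)

lemma mult_even_cube_group [simp]:
  "g \<in> even_cube_maps \<Longrightarrow> h \<in> even_cube_maps \<Longrightarrow> g \<otimes>\<^bsub>even_cube_group\<^esub> h = g \<circ> h"
  by (simp add: even_cube_group_eq BijGroup_simps Bij_UNIV bij_even_cube_map compose_def restrict_UNIV comp_def)

lemma one_even_cube_group [simp]: "\<one>\<^bsub>even_cube_group\<^esub> = id"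
  by (simp add: even_cube_group_eq BijGroup_simps restrict_UNIV id_def)

lemma inv_even_cube_group [simp]:
  assumes "g \<in> even_cube_maps"
  shows "inv\<^bsub>even_cube_group\<^esub> g = inv_into UNIV g"
proof (rule group.inv_equality[OF group_even_cube_group])
  show "inv_into UNIV g \<otimes>\<^bsub>even_cube_group\<^esub> g = \<one>\<^bsub>even_cube_group\<^esub>"
    using assms bij_even_cube_map[OF assms] by (simp add: even_cube_maps_inv bij_is_inj)
qed (use assms even_cube_maps_inv in auto)

text \<open>The normalizer is defined by equality of a conjugate with \<open>K\<close>. Conjugations
  by \<open>g\<close> and by its inverse undo each other, so this equality amounts to invariance
  under both, the form that \<open>lift_normalizes\<close> delivers.\<close>

lemma normalizer_even_cube_group_iff:
  assumes "K \<subseteq> even_cube_maps"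
  shows "g \<in> normalizer even_cube_group K \<longleftrightarrow> g \<in> even_cube_maps \<and>
    (\<forall>k \<in> K. g \<circ> k \<circ> inv_into UNIV g \<in> K) \<and> (\<forall>k \<in> K. inv_into UNIV g \<circ> k \<circ> g \<in> K)" (is "_ \<longleftrightarrow> ?R")
proof -
  let ?c = "\<lambda>k. g \<circ> k \<circ> inv_into UNIV g" and ?d = "\<lambda>k. inv_into UNIV g \<circ> k \<circ> g"
  have "g \<in> normalizer even_cube_group K \<longleftrightarrow> g \<in> even_cube_maps \<and> ?c ` K = K"
  proof (cases "g \<in> even_cube_maps")
    case True
    have gk: "g \<circ> k \<in> even_cube_maps" if "k \<in> K" for k using that assms True even_cube_maps_comp by blast
    have "g <#\<^bsub>even_cube_group\<^esub> K #>\<^bsub>even_cube_group\<^esub> inv_into UNIV g = ?c ` K"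
      using True assms gk even_cube_maps_inv[OF True] by (auto simp: l_coset_def r_coset_def subset_iff image_iff)
    then show ?thesis using True assms by (simp add: normalizer_def stabilizer_def)
  qed (simp add: normalizer_def stabilizer_def)
  moreover have "?c ` K = K \<longleftrightarrow> (\<forall>k \<in> K. ?c k \<in> K) \<and> (\<forall>k \<in> K. ?d k \<in> K)" if g: "g \<in> even_cube_maps"
  proof -
    have b: "bij g" using g by (rule bij_even_cube_map)
    have cd: "?c (?d k) = k" for k
      by (simp add: fun_eq_iff bij_is_surj[OF b] surj_f_inv_f)
    have dc: "?d (?c k) = k" for k
      by (simp add: fun_eq_iff inv_f_f[OF bij_is_inj[OF b]])
    show ?thesis
    proof
      assume eq: "?c ` K = K"
      have "?d k \<in> K" if "k \<in> K" for k
      proof -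
        have "k \<in> ?c ` K" using that eq by simp
        then obtain l where "l \<in> K" "k = ?c l" by (rule imageE) simp
        then show ?thesis using dc by simp
      qed
      moreover have "?c k \<in> K" if "k \<in> K" for k using imageI[OF that, of ?c] eq by simp
      ultimately show "(\<forall>k \<in> K. ?c k \<in> K) \<and> (\<forall>k \<in> K. ?d k \<in> K)" by simp
    next
      assume R: "(\<forall>k \<in> K. ?c k \<in> K) \<and> (\<forall>k \<in> K. ?d k \<in> K)"
      have "k \<in> ?c ` K" if "k \<in> K" for k using R that by (intro image_eqI[of _ _ "?d k"]) (simp_all only: cd)
      then show "?c ` K = K" using R by (intro equalityI subsetI) auto
    qed
  qed
  ultimately show ?thesis by blast
qed

text \<open>The infimum d_K bounds every single displacement from below, and
  \<open>gdist_cube_le\<close> passes from graph distance to Hamming distance.\<close>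

lemma subgroup_imp_sparse_even_group:
  fixes K :: "(bit ^ 'n \<Rightarrow> bit ^ 'n) set"
  assumes sub: "subgroup K (aut_group (with_proj cube))" and E: "K \<subseteq> even_cube_maps"
    and md: "min_displacement cube K \<ge> 7"
  shows "sparse_even_group K"
proof -
  have one: "\<one>\<^bsub>aut_group (with_proj cube)\<^esub> = (id :: bit ^ 'n \<Rightarrow> bit ^ 'n)"
    by (simp add: aut_group_def BijGroup_simps restrict_UNIV id_def)
  have id: "id \<in> K" using subgroup.one_closed[OF sub] one by simp
  have mult: "k \<otimes>\<^bsub>aut_group (with_proj cube)\<^esub> l = k \<circ> l" if "k \<in> K" "l \<in> K" for k l
    using mult_even_cube_group[of k l] that E by (auto simp: even_cube_group_def)
  have comp: "k \<circ> l \<in> K" if "k \<in> K" "l \<in> K" for k l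
    using subgroup.m_closed[OF sub that] mult[OF that] by simp
  have inv: "inv_into UNIV k \<in> K" if k: "k \<in> K" for k
  proof -
    interpret group "aut_group (with_proj (cube :: (bit ^ 'n) pair_pre_digraph))" by (rule group_aut_group)
    let ?l = "inv\<^bsub>aut_group (with_proj cube)\<^esub> k"
    have l: "?l \<in> K" using subgroup.m_inv_closed[OF sub k] .
    have "?l \<otimes>\<^bsub>aut_group (with_proj cube)\<^esub> k = \<one>\<^bsub>aut_group (with_proj cube)\<^esub>"
      using k subgroup.mem_carrier[OF sub] by simp
    then have "?l \<circ> k = id" using mult[OF l k] one by simp
    \<comment> \<open>A left inverse of a bijection is its inverse.\<close>
    then have "?l = inv_into UNIV k"
      using bij_even_cube_map k E by (metis bij_is_surj comp_assoc comp_id id_comp subsetD surj_iff)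
    then show ?thesis using l by simp
  qed
  have "7 \<le> hamming_dist v (k v)" if "k \<in> K" "k \<noteq> id" for k and v :: "bit ^ 'n"
  proof -
    have "min_displacement cube K \<le> gdist cube v (k v)"
      unfolding min_displacement_def one using that by (intro INF_lower2[of "(v, k)"]) auto
    then have "7 \<le> ereal (hamming_dist v (k v))"
      using md gdist_cube_le[of v "k v"] by (meson order_trans)
    then show ?thesis by simp
  qed
  then show "sparse_even_group K" using id comp inv E by unfold_locales auto
qed

section \<open>The action of the normalizer on a halved graph\<close>

context sparse_even_group
begin

abbreviation "N \<equiv> normalizer even_cube_group K"

lemma normalizer_iff:
  "g \<in> N \<longleftrightarrow> g \<in> even_cube_maps \<and>
    (\<forall>k \<in> K. g \<circ> k \<circ> inv_into UNIV g \<in> K) \<and> (\<forall>k \<in> K. inv_into UNIV g \<circ> k \<circ> g \<in> K)"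
  by (rule normalizer_even_cube_group_iff[OF K_even])

text \<open>Conjugating \<open>k\<close> by \<open>g\<close> moves it past \<open>g\<close>. Hence
  the action of \<open>N\<close> on orbits is just the image of sets, independent of
  representatives.\<close>

lemma image_orb:
  assumes "g \<in> N"
  shows "g ` orb K v = orb K (g v)"
proof -
  have g: "g \<in> even_cube_maps" using assms normalizer_iff by blast
  then have b: "bij g" by (rule bij_even_cube_map)
  show ?thesis
  proof
    show "g ` orb K v \<subseteq> orb K (g v)"
    proof
      fix w assume "w \<in> g ` orb K v"
      then obtain k where k: "k \<in> K" "w = g (k v)" by (auto simp: orb_eq)
      then have "w = (g \<circ> k \<circ> inv_into UNIV g) (g v)" using b by (simp add: bij_is_inj)
      then show "w \<in> orb K (g v)" using assms k(1) normalizer_iff orb_eq by blast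
    qed
    show "orb K (g v) \<subseteq> g ` orb K v"
    proof
      fix w assume "w \<in> orb K (g v)"
      then obtain k where k: "k \<in> K" "w = k (g v)" by (auto simp: orb_eq)
      then have "w = g ((inv_into UNIV g \<circ> k \<circ> g) v)" using b by (simp add: bij_is_surj surj_f_inv_f)
      then show "w \<in> g ` orb K v" using assms k(1) normalizer_iff orb_eq by blast
    qed
  qed
qed

context
  fixes \<Gamma> :: "((bit ^ 'n) set, (bit ^ 'n) set \<times> (bit ^ 'n) set) pre_digraph" and p :: bool
  assumes n: "CARD('n) \<ge> 5"
    and verts: "verts \<Gamma> = half_orbits p"
    and adj: "\<And>A B. A \<in> verts \<Gamma> \<Longrightarrow> B \<in> verts \<Gamma> \<Longrightarrow> A \<rightarrow>\<^bsub>\<Gamma>\<^esub> B \<longleftrightarrow> orbits_at_distance_2 A B"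
begin

text \<open>The restriction to vertices makes the map extensional, as elements of \<open>Bij\<close>
  must be.\<close>

definition orbit_map :: "(bit ^ 'n \<Rightarrow> bit ^ 'n) \<Rightarrow> (bit ^ 'n) set \<Rightarrow> (bit ^ 'n) set" where
  "orbit_map g = (\<lambda>A \<in> verts \<Gamma>. g ` A)"

lemma orb_in_verts_iff: "orb K v \<in> verts \<Gamma> \<longleftrightarrow> parity v = p"
  by (simp add: verts orb_in_half_orbits_iff)

lemma orbit_map_orb:
  assumes "g \<in> N" "parity v = p"
  shows "orbit_map g (orb K v) = orb K (g v)"
  using assms by (simp add: orbit_map_def orb_in_verts_iff image_orb)

lemma normalizer_even: "g \<in> N \<Longrightarrow> g \<in> even_cube_maps"
  using normalizer_iff by blast

lemma inv_in_normalizer: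
  assumes "g \<in> N"
  shows "inv_into UNIV g \<in> N"
  using assms normalizer_even[OF assms] unfolding normalizer_iff
  by (simp add: even_cube_maps_inv inv_inv_eq bij_even_cube_map)

lemma orbit_map_mem_verts:
  assumes "g \<in> N" "A \<in> verts \<Gamma>"
  shows "orbit_map g A \<in> verts \<Gamma>"
proof -
  obtain v where v: "A = orb K v" "parity v = p" using assms(2) by (auto simp: verts half_orbits_def)
  then show ?thesis
    using assms(1) by (simp add: orbit_map_orb orb_in_verts_iff parity_even_cube_map normalizer_even)
qed

lemma orbit_map_in_Bij:
  assumes "g \<in> N"
  shows "orbit_map g \<in> Bij (verts \<Gamma>)"
proof -
  have g: "bij g" using assms by (simp add: bij_even_cube_map normalizer_even)
  have h: "inv_into UNIV g \<in> N" using assms by (rule inv_in_normalizer)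
  have "bij_betw (orbit_map g) (verts \<Gamma>) (verts \<Gamma>)"
  proof (rule bij_betwI[where g = "orbit_map (inv_into UNIV g)"])
    show "orbit_map g \<in> verts \<Gamma> \<rightarrow> verts \<Gamma>" "orbit_map (inv_into UNIV g) \<in> verts \<Gamma> \<rightarrow> verts \<Gamma>"
      using orbit_map_mem_verts assms h by auto
  next
    fix A assume A: "A \<in> verts \<Gamma>"
    have "orbit_map (inv_into UNIV g) (orbit_map g A) = inv_into UNIV g ` g ` A"
      using A orbit_map_mem_verts[OF assms A] by (simp add: orbit_map_def)
    then show "orbit_map (inv_into UNIV g) (orbit_map g A) = A"
      using g by (simp add: bij_is_inj image_inv_f_f)
    have "orbit_map g (orbit_map (inv_into UNIV g) A) = g ` inv_into UNIV g ` A"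
      using A orbit_map_mem_verts[OF h A] by (simp add: orbit_map_def)
    then show "orbit_map g (orbit_map (inv_into UNIV g) A) = A"
      using g by (simp add: bij_is_surj image_f_inv_f)
  qed
  then show ?thesis by (simp add: Bij_def orbit_map_def)
qed

lemma orbits_at_distance_2_image:
  assumes "g \<in> even_cube_maps"
  shows "orbits_at_distance_2 (g ` A) (g ` B) \<longleftrightarrow> orbits_at_distance_2 A B"
  using assms by (simp add: orbits_at_distance_2_def)

lemma orbit_map_in_aut_group:
  assumes "g \<in> N"
  shows "orbit_map g \<in> carrier (aut_group \<Gamma>)"
proof -
  have "orbit_map g A \<rightarrow>\<^bsub>\<Gamma>\<^esub> orbit_map g B \<longleftrightarrow> A \<rightarrow>\<^bsub>\<Gamma>\<^esub> B" if "A \<in> verts \<Gamma>" "B \<in> verts \<Gamma>" for A B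
    using that adj[OF orbit_map_mem_verts[OF assms that(1)] orbit_map_mem_verts[OF assms that(2)]] adj[OF that]
    by (simp add: orbit_map_def orbits_at_distance_2_image normalizer_even assms)
  then show ?thesis using orbit_map_in_Bij[OF assms] by (simp add: aut_group_def)
qed

lemma subgroup_normalizer: "subgroup N even_cube_group"
  using group.normalizer_imp_subgroup[OF group_even_cube_group] K_even by simp

lemma orbit_map_group_hom:
  "group_hom (even_cube_group\<lparr>carrier := N\<rparr>) (aut_group \<Gamma>) orbit_map"
proof (intro group_hom.intro group_hom_axioms.intro)
  show "orbit_map \<in> hom (even_cube_group\<lparr>carrier := N\<rparr>) (aut_group \<Gamma>)"
  proof (rule homI)
    fix g h assume "g \<in> carrier (even_cube_group\<lparr>carrier := N\<rparr>)" "h \<in> carrier (even_cube_group\<lparr>carrier := N\<rparr>)"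
    then have gh: "g \<in> N" "h \<in> N" by simp_all
    have "orbit_map (g \<circ> h) = compose (verts \<Gamma>) (orbit_map g) (orbit_map h)"
    proof (rule extensionalityI[of _ "verts \<Gamma>"])
      fix A assume "A \<in> verts \<Gamma>"
      then show "orbit_map (g \<circ> h) A = compose (verts \<Gamma>) (orbit_map g) (orbit_map h) A"
        using orbit_map_mem_verts[OF gh(2), of A] by (simp add: orbit_map_def compose_eq image_comp)
    qed (simp_all add: orbit_map_def)
    then show "orbit_map (g \<otimes>\<^bsub>even_cube_group\<lparr>carrier := N\<rparr>\<^esub> h) = orbit_map g \<otimes>\<^bsub>aut_group \<Gamma>\<^esub> orbit_map h"
      using gh by (simp add: normalizer_even aut_group_def BijGroup_simps orbit_map_in_Bij)
  qed (simp add: orbit_map_in_aut_group)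
  show "group (even_cube_group\<lparr>carrier := N\<rparr>)" 
    by (rule subgroup.subgroup_is_group[OF subgroup_normalizer group_even_cube_group])
qed (rule group_aut_group)

lemma K_subset_normalizer: "K \<subseteq> N"
proof
  fix k assume k: "k \<in> K"
  then show "k \<in> N" unfolding normalizer_iff using K_even by (auto intro: comp_in inv_in)
qed

text \<open>Acting trivially means fixing all orbits of parity \<open>p\<close>, which puts
  \<open>g\<close> in \<open>K\<close> by \<open>fixes_half_orbits_imp_mem\<close>; conversely
  \<open>K\<close> fixes each of its orbits.\<close>

lemma kernel_orbit_map: "kernel (even_cube_group\<lparr>carrier := N\<rparr>) (aut_group \<Gamma>) orbit_map = K"
proof -
  have one: "\<one>\<^bsub>aut_group \<Gamma>\<^esub> = (\<lambda>A \<in> verts \<Gamma>. A)" by (simp add: aut_group_def BijGroup_simps)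
  have "orbit_map g = (\<lambda>A \<in> verts \<Gamma>. A) \<longleftrightarrow> g \<in> K" if g: "g \<in> N" for g
  proof
    assume eq: "orbit_map g = (\<lambda>A \<in> verts \<Gamma>. A)"
    show "g \<in> K"
    proof (rule fixes_half_orbits_imp_mem[of g p])
      fix v :: "bit ^ 'n" assume v: "parity v = p"
      show "orb K (g v) = orb K v"
        using orbit_map_orb[OF g v] eq v by (simp add: orb_in_verts_iff)
    qed (use n g normalizer_even in auto)
  next
    assume k: "g \<in> K"
    show "orbit_map g = (\<lambda>A \<in> verts \<Gamma>. A)"
    proof (rule extensionalityI[of _ "verts \<Gamma>"])
      fix A assume A: "A \<in> verts \<Gamma>"
      obtain v where v: "A = orb K v" "parity v = p" using A by (auto simp: verts half_orbits_def)
      then show "orbit_map g A = (\<lambda>A \<in> verts \<Gamma>. A) A"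
        using A g k by (simp add: orbit_map_orb orb_apply)
    qed (simp_all add: orbit_map_def)
  qed
  then show ?thesis using K_subset_normalizer by (auto simp: kernel_def one)
qed

text \<open>An automorphism has a lift by \<open>ex_lift\<close>, and \<open>lift_normalizes\<close>
  puts the lift in \<open>N\<close>.\<close>

lemma orbit_map_surj: "orbit_map ` N = carrier (aut_group \<Gamma>)"
proof
  show "orbit_map ` N \<subseteq> carrier (aut_group \<Gamma>)" using orbit_map_in_aut_group by blast
  show "carrier (aut_group \<Gamma>) \<subseteq> orbit_map ` N"
  proof
    fix f assume "f \<in> carrier (aut_group \<Gamma>)"
    then have f: "f \<in> extensional (verts \<Gamma>)" "bij_betw f (verts \<Gamma>) (verts \<Gamma>)"
      and f_arc: "\<And>A B. A \<in> verts \<Gamma> \<Longrightarrow> B \<in> verts \<Gamma> \<Longrightarrow> f A \<rightarrow>\<^bsub>\<Gamma>\<^esub> f B \<longleftrightarrow> A \<rightarrow>\<^bsub>\<Gamma>\<^esub> B"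
      by (auto simp: aut_group_def Bij_def)
    have f_bij: "bij_betw f (half_orbits p) (half_orbits p)" using f(2) by (simp add: verts)
    have f_adj: "orbits_at_distance_2 (f A) (f B) \<longleftrightarrow> orbits_at_distance_2 A B"
      if "A \<in> half_orbits p" "B \<in> half_orbits p" for A B
      using that adj[of A B] adj[of "f A" "f B"] f_arc[of A B] bij_betwE[OF f_bij] by (simp add: verts)
    obtain g where g: "g \<in> even_cube_maps" "\<And>v. parity v = p \<Longrightarrow> f (orb K v) = orb K (g v)"
      using ex_lift[OF n f_bij f_adj] by blast
    have gN: "g \<in> N"
      using g(1) lift_normalizes[OF n f_bij f_adj g] unfolding normalizer_iff by blast
    have "f = orbit_map g"
    proof (rule extensionalityI[OF f(1)])
      fix A assume A: "A \<in> verts \<Gamma>"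
      obtain v where v: "A = orb K v" "parity v = p" using A by (auto simp: verts half_orbits_def)
      then show "f A = orbit_map g A" using g(2) gN by (simp add: orbit_map_orb)
    qed (simp add: orbit_map_def)
    then show "f \<in> orbit_map ` N" using gN by blast
  qed
qed

lemma quotient_iso_aut_group:
  "\<exists>\<Phi> \<in> iso (even_cube_group\<lparr>carrier := N\<rparr> Mod K) (aut_group \<Gamma>).
     \<forall>g \<in> N. \<forall>x. orb K x \<in> verts \<Gamma> \<longrightarrow> \<Phi> (K #>\<^bsub>even_cube_group\<^esub> g) (orb K x) = orb K (g x)"
proof (intro bexI ballI allI impI)
  interpret group_hom "even_cube_group\<lparr>carrier := N\<rparr>" "aut_group \<Gamma>" orbit_map
    by (rule orbit_map_group_hom)
  \<comment> \<open>The isomorphism of the first isomorphism theorem: a coset goes to the common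
    value of \<open>orbit_map\<close> on its elements.\<close>
  show "(\<lambda>C. the_elem (orbit_map ` C)) \<in> iso (even_cube_group\<lparr>carrier := N\<rparr> Mod K) (aut_group \<Gamma>)"
    using FactGroup_iso_set orbit_map_surj kernel_orbit_map by simp
  fix g x assume g: "g \<in> N" and x: "orb K x \<in> verts \<Gamma>"
  \<comment> \<open>\<open>K\<close> acts trivially, so \<open>orbit_map\<close> is constant on the
    coset of \<open>g\<close>; this evaluates \<open>the_elem\<close>.\<close>
  have "orbit_map (k \<circ> g) = orbit_map g" if k: "k \<in> K" for k
  proof -
    have "orbit_map k = \<one>\<^bsub>aut_group \<Gamma>\<^esub>" using k kernel_orbit_map by (auto simp: kernel_def)
    moreover have "k \<in> N" using k K_subset_normalizer by blast
    ultimately show ?thesis using hom_mult[of k g] g by (simp add: normalizer_even orbit_map_in_aut_group)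
  qed
  then have "(\<lambda>k. orbit_map (k \<circ> g)) ` K = {orbit_map g}"
    using id_in by (auto intro!: image_eqI[of _ _ id])
  moreover have "K #>\<^bsub>even_cube_group\<^esub> g = (\<lambda>k. k \<circ> g) ` K"
    using K_even normalizer_even[OF g] by (auto simp: r_coset_def subset_iff image_iff)
  ultimately have "orbit_map ` (K #>\<^bsub>even_cube_group\<^esub> g) = {orbit_map g}"
    by (simp add: image_image)
  then show "the_elem (orbit_map ` (K #>\<^bsub>even_cube_group\<^esub> g)) (orb K x) = orb K (g x)"
    using g x by (simp add: orbit_map_orb orb_in_verts_iff)
qed

end

end

theorem theorem1p5:
  fixes K :: "(bit ^ 'n \<Rightarrow> bit ^ 'n) set"
    and \<Gamma> :: "((bit ^ 'n) set, (bit ^ 'n) set \<times> (bit ^ 'n) set) pre_digraph"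
  assumes "CARD('n) \<ge> 5"
    and "subgroup K (aut_group (with_proj cube))"
    and "K \<subseteq> even_cube_maps"
    and "min_displacement cube K \<ge> 7"
    and "\<Gamma> \<in> halved_graphs (normal_quotient cube K)"
  shows "\<exists>\<Phi> \<in> iso (even_cube_group\<lparr>carrier := normalizer even_cube_group K\<rparr> Mod K) (aut_group \<Gamma>).
           \<forall>g \<in> normalizer even_cube_group K. \<forall>x. orb K x \<in> verts \<Gamma> \<longrightarrow>
             \<Phi> (K #>\<^bsub>even_cube_group\<^esub> g) (orb K x) = orb K (g x)"
proof -
  interpret sparse_even_group K
    using assms(2-4) by (rule subgroup_imp_sparse_even_group)
  obtain p where p: "verts \<Gamma> = half_orbits p"
    and adj: "\<forall>A \<in> verts \<Gamma>. \<forall>B \<in> verts \<Gamma>. A \<rightarrow>\<^bsub>\<Gamma>\<^esub> B \<longleftrightarrow> orbits_at_distance_2 A B"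
    using halved_graph_normal_quotient[OF assms(5)] by blast
  show ?thesis
    by (rule quotient_iso_aut_group[OF assms(1) p]) (use adj in blast)
qed

end
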